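(* There is a universal constant $c_0>0$ such that the following holds. For any integers $O\ge3$, $A\ge2$, $Q\ge2$, $E\ge4$, any $D^\times\ge Q(6+2\log_A(O))$ and any $T\ge D^\times OA$, there exists a family of MDPRMs with deterministic reward machines, each having $O$ observation states, $A$ actions, $Q$ RM states, maximum number of relevant labels $E$, and whose associated cross-product MDP has diameter $D^\times$, such that for every learning algorithm $\mathbb A$ there is an MDPRM in the family on which $$\mathbb E[\mathfrak R(\mathbb A,T)]\ge c_0\sqrt{D^\times OAT}.$$
   Context: An MDPRM with deterministic reward machine (RM) is a tuple $M=(\mathcal O,\mathcal A,P,\mathcal R,\mathsf{AP},L)$. Here $\mathcal O$ (observation states), $\mathcal A$ (actions) and $\mathsf{AP}$ (atomic propositions) are finite sets, $P(\cdot|o,a)$ is a probability distribution on $\mathcal O$ for each $(o,a)$, and $L:\mathcal O\times\mathcal A\to2^{\mathsf{AP}}$ is a labeling function. The RM is $\mathcal R=(\mathcal Q,2^{\mathsf{AP}},\tau,\nu)$ with finite state set $\mathcal Q$, transition function $\tau:\mathcal Q\times2^{\mathsf{AP}}\to\mathcal Q$ with $\tau(q,\emptyset)=q$, and output $\nu(q,\sigma)$ a reward distribution on $[0,1]$. $\mathcal E_q\subseteq2^{\mathsf{AP}}$ is the set of relevant labels at $q$ (it contains every label that can be received in RM state $q$), and $E=\max_q|\mathcal E_q|$. Interaction: at time $t$ the agent observes $(q_t,o_t)$ and chooses $a_t$ (possibly at random) based on the past. The label is $\sigma_t=L(o_t,a_t)$ and the agent receives $r_t\sim\nu(q_t,\sigma_t)$.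 Then $o_{t+1}\sim P(\cdot|o_t,a_t)$ and $q_{t+1}=\tau(q_t,\sigma_t)$. A learning algorithm $\mathbb A$ is any rule mapping the observed history (and current state) to (a distribution over) actions; it does not know which member of the family it is interacting with. The cross-product MDP $M^\times$ has states $\mathcal S=\mathcal Q\times\mathcal O$, actions $\mathcal A$, transitions $P^\times((q',o')|(q,o),a)=P(o'|o,a)\,\mathbb I\{q'=\tau(q,L(o,a))\}$ and reward distributions $\nu(q,L(o,a))$. Its diameter is $\max_{s\ne s'}\min_{\pi:\mathcal S\to\mathcal A}\mathbb E[T^\pi(s,s')]$, where $T^\pi(s,s')$ is the number of steps to reach $s'$ from $s$ under $\pi$. Let $g^\star$ be the optimal long-run average reward (independent of the starting state when the diameter is finite). The regret is $\mathfrak R(\mathbb A,T)=Tg^\star-\sum_{t=1}^Tr_t$. *)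

theory Defs
  imports "HOL-Probability.Probability"
begin

section \<open>Markov decision processes\<close>

record ('s, 'a) mdp =
  mdp_states :: "'s set"
  mdp_actions :: "'a set"
  mdp_trans :: "'s \<Rightarrow> 'a \<Rightarrow> 's pmf"
  mdp_reward :: "'s \<Rightarrow> 'a \<Rightarrow> real measure"

definition step_space :: "('s \<times> 'a \<times> real) measure" where
  "step_space = count_space UNIV \<Otimes>\<^sub>M count_space UNIV \<Otimes>\<^sub>M borel"

text \<open>
  A decision rule maps the time \<open>t\<close>, the history of the rounds \<open>0, ..., t - 1\<close> and the current
  state to a distribution on actions.  A history is an extensional function on \<open>{0..<t}\<close>, so nothing
  beyond the past is visible; \<open>X\<close> is the measurable space of what is recorded in one round.
\<close>

definition decision_rule ::
    "'x measure \<Rightarrow> 'a set \<Rightarrow> (nat \<Rightarrow> (nat \<Rightarrow> 'x) \<Rightarrow> 's \<Rightarrow> 'a pmf) \<Rightarrow> bool" where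
  "decision_rule X A \<pi> \<longleftrightarrow>
     (\<forall>t h s. set_pmf (\<pi> t h s) \<subseteq> A) \<and>
     (\<forall>t s a. (\<lambda>h. pmf (\<pi> t h s) a) \<in> borel_measurable (PiM {0..<t} (\<lambda>_. X)))"

text \<open>The conditional law of round \<open>t\<close>, that is of \<open>(s\<^sub>t, a\<^sub>t, r\<^sub>t)\<close>, given the earlier rounds.\<close>

definition choice_pmf ::
    "('s, 'a) mdp \<Rightarrow> (nat \<Rightarrow> (nat \<Rightarrow> 's \<times> 'a \<times> real) \<Rightarrow> 's \<Rightarrow> 'a pmf) \<Rightarrow> 's \<Rightarrow>
     nat \<Rightarrow> (nat \<Rightarrow> 's \<times> 'a \<times> real) \<Rightarrow> ('s \<times> 'a) pmf" where
  "choice_pmf N \<pi> s\<^sub>1 t h =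
     bind_pmf
       (if t = 0 then return_pmf s\<^sub>1 else mdp_trans N (fst (h (t - 1))) (fst (snd (h (t - 1)))))
       (\<lambda>s. map_pmf (Pair s) (\<pi> t h s))"

definition step_kernel ::
    "('s, 'a) mdp \<Rightarrow> (nat \<Rightarrow> (nat \<Rightarrow> 's \<times> 'a \<times> real) \<Rightarrow> 's \<Rightarrow> 'a pmf) \<Rightarrow> 's \<Rightarrow>
     nat \<Rightarrow> (nat \<Rightarrow> 's \<times> 'a \<times> real) \<Rightarrow> ('s \<times> 'a \<times> real) measure" where
  "step_kernel N \<pi> s\<^sub>1 t h =
     measure_pmf (choice_pmf N \<pi> s\<^sub>1 t h) \<bind>
       (\<lambda>(s, a). distr (mdp_reward N s a) step_space (\<lambda>r. (s, a, r)))"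

text \<open>
  The law of the infinite trajectory started in \<open>s\<^sub>1\<close>, obtained from the Ionescu-Tulcea theorem.
  Rounds are numbered from 0.
\<close>

definition trajectory ::
    "('s, 'a) mdp \<Rightarrow> (nat \<Rightarrow> (nat \<Rightarrow> 's \<times> 'a \<times> real) \<Rightarrow> 's \<Rightarrow> 'a pmf) \<Rightarrow> 's \<Rightarrow>
     (nat \<Rightarrow> 's \<times> 'a \<times> real) measure" where
  "trajectory N \<pi> s\<^sub>1 =
     projective_family.lim UNIV
       (Ionescu_Tulcea.CI (step_kernel N \<pi> s\<^sub>1) (\<lambda>_. step_space)) (\<lambda>_. step_space)"

definition total_reward :: "nat \<Rightarrow> (nat \<Rightarrow> 's \<times> 'a \<times> real) \<Rightarrow> real" where
  "total_reward T \<omega> = (\<Sum>t<T. snd (snd (\<omega> t)))"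

definition stationary :: "('s \<Rightarrow> 'a) \<Rightarrow> nat \<Rightarrow> (nat \<Rightarrow> 's \<times> 'a \<times> real) \<Rightarrow> 's \<Rightarrow> 'a pmf" where
  "stationary \<pi> t h s = return_pmf (\<pi> s)"

definition hitting_time :: "'s \<Rightarrow> (nat \<Rightarrow> 's \<times> 'a \<times> real) \<Rightarrow> ennreal" where
  "hitting_time s' \<omega> = (INF t\<in>{t. fst (\<omega> t) = s'}. of_nat t)"

definition diameter_mdp :: "('s, 'a) mdp \<Rightarrow> ennreal" where
  "diameter_mdp N =
     (SUP (s, s')\<in>{(s, s'). s \<in> mdp_states N \<and> s' \<in> mdp_states N \<and> s \<noteq> s'}.
        INF \<pi>\<in>mdp_states N \<rightarrow>\<^sub>E mdp_actions N.
          \<integral>\<^sup>+ \<omega>. hitting_time s' \<omega> \<partial>trajectory N (stationary \<pi>) s)"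

text \<open>
  The optimal long-run average reward from \<open>s\<^sub>1\<close>, over all history-dependent randomized policies.
\<close>

definition optimal_gain :: "('s, 'a) mdp \<Rightarrow> 's \<Rightarrow> real" where
  "optimal_gain N s\<^sub>1 =
     real_of_ereal (SUP \<pi>\<in>{\<pi>. decision_rule step_space (mdp_actions N) \<pi>}.
       liminf (\<lambda>n. ereal ((\<integral>\<omega>. total_reward n \<omega> \<partial>trajectory N \<pi> s\<^sub>1) / real n)))"


section \<open>MDPs with deterministic reward machines\<close>

record ('q, 'p) reward_machine =
  rm_states :: "'q set"
  rm_trans :: "'q \<Rightarrow> 'p set \<Rightarrow> 'q"
  rm_output :: "'q \<Rightarrow> 'p set \<Rightarrow> real measure"
  relevant_labels :: "'q \<Rightarrow> 'p set set"

record ('q, 'o, 'a, 'p) mdprm =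
  obs_set :: "'o set"
  act_set :: "'a set"
  obs_trans :: "'o \<Rightarrow> 'a \<Rightarrow> 'o pmf"
  machine :: "('q, 'p) reward_machine"
  props :: "'p set"
  label :: "'o \<Rightarrow> 'a \<Rightarrow> 'p set"

text \<open>
  The output distributions are required to be well-behaved also at arguments outside the carriers;
  this only fixes irrelevant values and makes the kernel above measurable everywhere.
  In a communicating cross product every pair \<open>(q, x)\<close> can occur, so the labels that can be received
  in \<open>q\<close> are the \<open>label M x a\<close>.  The set of relevant labels may contain further ones.
\<close>

definition is_reward_machine :: "'p set \<Rightarrow> ('q, 'p) reward_machine \<Rightarrow> bool" where
  "is_reward_machine AP R \<longleftrightarrow>
     finite (rm_states R) \<and> rm_states R \<noteq> {} \<and>
     (\<forall>q\<in>rm_states R. \<forall>\<sigma>\<in>Pow AP. rm_trans R q \<sigma> \<in> rm_states R) \<and>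
     (\<forall>q\<in>rm_states R. rm_trans R q {} = q) \<and>
     (\<forall>q \<sigma>. prob_space (rm_output R q \<sigma>) \<and> sets (rm_output R q \<sigma>) = sets borel \<and>
            (AE r in rm_output R q \<sigma>. r \<in> {0..1})) \<and>
     (\<forall>q\<in>rm_states R. relevant_labels R q \<subseteq> Pow AP)"

definition is_mdprm :: "('q, 'o, 'a, 'p) mdprm \<Rightarrow> bool" where
  "is_mdprm M \<longleftrightarrow>
     finite (obs_set M) \<and> obs_set M \<noteq> {} \<and>
     finite (act_set M) \<and> act_set M \<noteq> {} \<and>
     finite (props M) \<and>
     (\<forall>x\<in>obs_set M. \<forall>a\<in>act_set M. set_pmf (obs_trans M x a) \<subseteq> obs_set M) \<and>
     (\<forall>x\<in>obs_set M. \<forall>a\<in>act_set M. label M x a \<in> Pow (props M)) \<and>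
     is_reward_machine (props M) (machine M) \<and>
     (\<forall>q\<in>rm_states (machine M). \<forall>x\<in>obs_set M. \<forall>a\<in>act_set M.
        label M x a \<in> relevant_labels (machine M) q)"

definition max_relevant :: "('q, 'o, 'a, 'p) mdprm \<Rightarrow> nat" where
  "max_relevant M = Max ((\<lambda>q. card (relevant_labels (machine M) q)) ` rm_states (machine M))"

definition cross_product :: "('q, 'o, 'a, 'p) mdprm \<Rightarrow> ('q \<times> 'o, 'a) mdp" where
  "cross_product M =
     \<lparr>mdp_states = rm_states (machine M) \<times> obs_set M,
      mdp_actions = act_set M,
      mdp_trans = (\<lambda>(q, x) a. map_pmf (Pair (rm_trans (machine M) q (label M x a))) (obs_trans M x a)),
      mdp_reward = (\<lambda>(q, x) a. rm_output (machine M) q (label M x a))\<rparr>"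


section \<open>Learning algorithms and regret\<close>

text \<open>The learner records state, action, received label and reward of each round.\<close>

definition observation_space :: "(('q \<times> 'o) \<times> 'a \<times> 'p set \<times> real) measure" where
  "observation_space =
     count_space UNIV \<Otimes>\<^sub>M count_space UNIV \<Otimes>\<^sub>M count_space UNIV \<Otimes>\<^sub>M borel"

type_synonym ('q, 'o, 'a, 'p) learner =
  "nat \<Rightarrow> (nat \<Rightarrow> ('q \<times> 'o) \<times> 'a \<times> 'p set \<times> real) \<Rightarrow> 'q \<times> 'o \<Rightarrow> 'a pmf"

definition learning_algorithm :: "'a set \<Rightarrow> ('q, 'o, 'a, 'p) learner \<Rightarrow> bool" where
  "learning_algorithm A alg \<longleftrightarrow> decision_rule observation_space A alg"

definition observe ::
    "('q, 'o, 'a, 'p) mdprm \<Rightarrow> ('q \<times> 'o) \<times> 'a \<times> real \<Rightarrow> ('q \<times> 'o) \<times> 'a \<times> 'p set \<times> real" where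
  "observe M = (\<lambda>((q, x), a, r). ((q, x), a, label M x a, r))"

definition interaction ::
    "('q, 'o, 'a, 'p) mdprm \<Rightarrow> ('q, 'o, 'a, 'p) learner \<Rightarrow> 'q \<times> 'o \<Rightarrow>
     (nat \<Rightarrow> ('q \<times> 'o) \<times> 'a \<times> real) measure" where
  "interaction M alg s\<^sub>1 =
     trajectory (cross_product M) (\<lambda>t h s. alg t (\<lambda>i\<in>{0..<t}. observe M (h i)) s) s\<^sub>1"

definition regret ::
    "('q, 'o, 'a, 'p) mdprm \<Rightarrow> 'q \<times> 'o \<Rightarrow> nat \<Rightarrow> (nat \<Rightarrow> ('q \<times> 'o) \<times> 'a \<times> real) \<Rightarrow> real" where
  "regret M s\<^sub>1 T \<omega> = real T * optimal_gain (cross_product M) s\<^sub>1 - total_reward T \<omega>"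

definition expected_regret ::
    "('q, 'o, 'a, 'p) mdprm \<Rightarrow> ('q, 'o, 'a, 'p) learner \<Rightarrow> 'q \<times> 'o \<Rightarrow> nat \<Rightarrow> real" where
  "expected_regret M alg s\<^sub>1 T = (\<integral>\<omega>. regret M s\<^sub>1 T \<omega> \<partial>interaction M alg s\<^sub>1)"


section \<open>The trajectory laws are well defined\<close>

lemma pmf_measurable_count:
  fixes f :: "'b \<Rightarrow> 'c::countable pmf"
  assumes [measurable]: "\<And>x. (\<lambda>y. pmf (f y) x) \<in> borel_measurable M"
  shows "(\<lambda>y. measure_pmf (f y)) \<in> measurable M (subprob_algebra (count_space UNIV))"
proof (rule measurable_subprob_algebra)
  fix y show "subprob_space (measure_pmf (f y))" by (rule measure_pmf.subprob_space_axioms)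
next
  fix A :: "'c set"
  have "emeasure (measure_pmf (f y)) A = (\<Sum>n. if n \<in> to_nat ` A then ennreal (pmf (f y) (from_nat n)) else 0)" for y
  proof -
    have "emeasure (measure_pmf (f y)) A = (\<integral>\<^sup>+x. ennreal (pmf (f y) x) * indicator A x \<partial>count_space UNIV)"
      by (subst nn_integral_measure_pmf[symmetric]) simp
    also have "\<dots> = (\<integral>\<^sup>+x. ennreal (pmf (f y) (from_nat x)) * indicator A (from_nat x) * indicator (range (to_nat::'c\<Rightarrow>nat)) x \<partial>count_space UNIV)"
      using nn_integral_bij_count_space[of to_nat UNIV "range (to_nat::'c\<Rightarrow>nat)" "\<lambda>x. ennreal (pmf (f y) (from_nat x)) * indicator A (from_nat x :: 'c)", OF bij_betw_imageI[OF inj_to_nat refl]]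
      by (simp add: nn_integral_count_space_indicator)
    also have "\<dots> = (\<Sum>n. if n \<in> to_nat ` A then ennreal (pmf (f y) (from_nat n)) else 0)"
      by (subst nn_integral_count_space_nat) (auto intro!: suminf_cong split: split_indicator)
    finally show ?thesis .
  qed
  moreover have "(\<lambda>y. (\<Sum>n. if n \<in> to_nat ` A then ennreal (pmf (f y) (from_nat n)) else 0)) \<in> borel_measurable M"
    by measurable
  ultimately show "(\<lambda>y. emeasure (measure_pmf (f y)) A) \<in> borel_measurable M" by simp
qed simp

lemma Ionescu_Tulcea_step_kernel:
  fixes N :: "('s::countable, 'a::countable) mdp"
  assumes rew: "\<And>s a. prob_space (mdp_reward N s a)" "\<And>s a. sets (mdp_reward N s a) = sets borel"
  assumes rule: "decision_rule step_space A \<pi>"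
  shows "Ionescu_Tulcea (step_kernel N \<pi> s\<^sub>1) (\<lambda>_. step_space)"
proof (rule Ionescu_Tulcea.intro)
  let ?F = "\<lambda>(s, a). distr (mdp_reward N s a) step_space (\<lambda>r. (s, a, r))"
  have m[measurable]: "(\<lambda>r. (s, a, r)) \<in> measurable (mdp_reward N s a) step_space" for s a
    unfolding step_space_def measurable_cong_sets[OF rew(2) refl] by measurable
  have F_prob: "prob_space (?F z)" for z
    by (cases z) (auto intro!: prob_space.prob_space_distr rew m)
  have F: "?F \<in> measurable (count_space UNIV) (subprob_algebra step_space)"
    by (auto simp: space_subprob_algebra intro!: prob_space_imp_subprob_space prob_space.prob_space_distr rew m)
  show "prob_space (step_kernel N \<pi> s\<^sub>1 i x)" for i x
  proof -
    have "?F \<in> measurable (measure_pmf (choice_pmf N \<pi> s\<^sub>1 i x)) (subprob_algebra step_space)"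
      using F by (simp cong: measurable_cong_sets)
    with F_prob show ?thesis unfolding step_kernel_def
      by (intro measure_pmf.prob_space_bind[where S=step_space] AE_pmfI) auto
  qed
  show "step_kernel N \<pi> s\<^sub>1 t \<in> measurable (PiM {0..<t} (\<lambda>_. step_space)) (subprob_algebra step_space)" for t
  proof -
    let ?H = "PiM {0..<t} (\<lambda>_. step_space) :: (nat \<Rightarrow> 's \<times> 'a \<times> real) measure"
    have p[measurable]: "(\<lambda>h. measure_pmf (\<pi> t h s)) \<in> measurable ?H (subprob_algebra (count_space UNIV))" for s
      by (rule pmf_measurable_count) (use rule in \<open>auto simp: decision_rule_def\<close>)
    have c: "fst \<in> measurable step_space (count_space (UNIV::'s set))" 
            "(\<lambda>x. fst (snd x)) \<in> measurable step_space (count_space (UNIV::'a set))"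
      unfolding step_space_def by measurable
    have s: "(\<lambda>h. measure_pmf (if t = 0 then return_pmf s\<^sub>1 else mdp_trans N (fst (h (t - 1))) (fst (snd (h (t - 1))))))
       \<in> measurable ?H (subprob_algebra (count_space UNIV))"
    proof (cases "t = 0")
      case True then show ?thesis by (auto simp: space_subprob_algebra intro!: measurable_const measure_pmf.subprob_space_axioms)
    next
      case False
      then have h: "(\<lambda>h. h (t-1)) \<in> measurable ?H step_space" by (intro measurable_component_singleton) auto
      have k: "(\<lambda>(s, a). measure_pmf (mdp_trans N s a)) \<in> measurable (count_space UNIV \<Otimes>\<^sub>M count_space UNIV) (subprob_algebra (count_space UNIV))"
        by (simp add: pair_measure_countable space_subprob_algebra measure_pmf.subprob_space_axioms split_beta)
      show ?thesis using False measurable_compose[OF measurable_Pair[OF measurable_compose[OF h c(1)] measurable_compose[OF h c(2)]] k] 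
        by simp
    qed
    have j: "(\<lambda>h. measure_pmf (choice_pmf N \<pi> s\<^sub>1 t h)) \<in> measurable ?H (subprob_algebra (count_space UNIV))"
      unfolding choice_pmf_def measure_pmf_bind
    proof (rule measurable_bind[OF s])
      show "(\<lambda>x. measure_pmf (map_pmf (Pair (snd x)) (\<pi> t (fst x) (snd x)))) \<in>
         measurable (?H \<Otimes>\<^sub>M count_space UNIV) (subprob_algebra (count_space UNIV))"
      proof (rule measurable_compose_countable[where f="\<lambda>s x. measure_pmf (map_pmf (Pair s) (\<pi> t (fst x) s))" and g=snd])
        fix s
        have "(\<lambda>h. distr (measure_pmf (\<pi> t h s)) (count_space UNIV) (Pair s)) \<in> measurable ?H (subprob_algebra (count_space UNIV))"
          by (rule measurable_distr2[OF _ p]) (simp add: pair_measure_countable measurable_pair_swap_iff[symmetric])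
        then show "(\<lambda>x. measure_pmf (map_pmf (Pair s) (\<pi> t (fst x) s))) \<in> measurable (?H \<Otimes>\<^sub>M count_space UNIV) (subprob_algebra (count_space UNIV))"
          by (intro measurable_compose[OF measurable_fst]) (simp add: map_pmf_rep_eq)
      qed measurable
    qed
    show ?thesis unfolding step_kernel_def
      by (rule measurable_bind2[OF j F])
  qed
qed

lemma prob_space_trajectory:
  fixes N :: "('s::countable, 'a::countable) mdp"
  assumes "\<And>s a. prob_space (mdp_reward N s a)" "\<And>s a. sets (mdp_reward N s a) = sets borel"
  assumes "decision_rule step_space A \<pi>"
  shows "prob_space (trajectory N \<pi> s\<^sub>1)"
    and "sets (trajectory N \<pi> s\<^sub>1) = sets (PiM UNIV (\<lambda>_. step_space))"
proof -
  interpret IT: Ionescu_Tulcea "step_kernel N \<pi> s\<^sub>1" "\<lambda>_. step_space"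
    by (rule Ionescu_Tulcea_step_kernel[OF assms])
  show "prob_space (trajectory N \<pi> s\<^sub>1)"
    unfolding trajectory_def
  proof (rule prob_space_distrD)
    show "(\<lambda>x. restrict x {0}) \<in> measurable IT.PF.lim (PiM {0} (\<lambda>_. step_space))"
      by (simp add: measurable_cong_sets[OF IT.PF.sets_lim refl] measurable_restrict_subset)
    show "prob_space (distr IT.PF.lim (PiM {0} (\<lambda>_. step_space)) (\<lambda>x. restrict x {0}))"
      using IT.PF.prob_space_P[of "{0}"] by (simp add: IT.distr_lim)
  qed
  show "sets (trajectory N \<pi> s\<^sub>1) = sets (PiM UNIV (\<lambda>_. step_space))"
    unfolding trajectory_def by simp
qed

lemma decision_rule_learner:
  fixes M :: "('q::countable, 'o::countable, 'a::countable, 'p) mdprm"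
  assumes "learning_algorithm A alg"
  shows "decision_rule step_space A (\<lambda>t h s. alg t (\<lambda>i\<in>{0..<t}. observe M (h i)) s)"
proof -
  have [measurable]: "fst \<in> measurable (step_space :: (('q \<times> 'o) \<times> 'a \<times> real) measure) (count_space UNIV)"
    "(\<lambda>x. fst (snd x)) \<in> measurable (step_space :: (('q \<times> 'o) \<times> 'a \<times> real) measure) (count_space UNIV)"
    "(\<lambda>x. snd (snd x)) \<in> measurable (step_space :: (('q \<times> 'o) \<times> 'a \<times> real) measure) borel"
    unfolding step_space_def by measurable
  have "(\<lambda>(s, a). label M (snd s) a) \<in> measurable
      (count_space UNIV \<Otimes>\<^sub>M count_space UNIV :: (('q \<times> 'o) \<times> 'a) measure) (count_space UNIV)"
    by (simp add: pair_measure_countable)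
  from measurable_compose[OF _ this, of "\<lambda>x. (fst x, fst (snd x))" step_space]
  have [measurable]: "(\<lambda>x. label M (snd (fst x)) (fst (snd x))) \<in>
      measurable (step_space :: (('q \<times> 'o) \<times> 'a \<times> real) measure) (count_space UNIV)"
    by simp
  have "observe M = (\<lambda>x. (fst x, fst (snd x), label M (snd (fst x)) (fst (snd x)), snd (snd x)))"
    by (auto simp: observe_def)
  then have [measurable]: "observe M \<in> measurable step_space observation_space"
    unfolding observation_space_def by simp
  have "(\<lambda>h. \<lambda>i\<in>{0..<t}. observe M (h i)) \<in>
      measurable (PiM {0..<t} (\<lambda>_. step_space)) (PiM {0..<t} (\<lambda>_. observation_space))" for t
    by measurable
  from measurable_compose[OF this] assms show ?thesis
    unfolding learning_algorithm_def decision_rule_def by blast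
qed

end

theory Submission
  imports Defs
begin

text \<open>
  In the observation state \<open>G\<close> the agent can step through the reward machine states at will; leaving \<open>G\<close>
  takes expected time \<open>1 / \<gamma>\<close> and leads through an \<open>A\<close>-ary tree to a leaf of the agent's choice.  A
  leaf pays 1 per round and falls back to \<open>G\<close> with probability \<open>\<delta>\<close>, but for one hidden pair of a leaf
  and an action only with probability \<open>\<delta> - \<epsilon>\<close>.  Since every leaf has an ordinary action and the hidden
  one only slows down the process, the diameter does not depend on \<open>\<epsilon>\<close> or the hidden pair and can be
  tuned to \<open>D\<close> through \<open>1 / \<gamma> + 1 / \<delta>\<close>.  Inner tree nodes pay the gain of the system with \<open>\<epsilon> = 0\<close>, so
  with the potential that is 0 at \<open>G\<close> and \<open>1 / (\<gamma> + \<delta>)\<close> elsewhere the expected total reward exceeds that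
  gain only by \<open>\<epsilon> / (\<gamma> + \<delta>)\<close> per use of the hidden pair.  Some pair is rarely used when \<open>\<epsilon> = 0\<close>, and
  comparing relative entropies shows that it is still rarely used if it is the hidden one.
  The family contains a copy for every choice of the observation state that plays the role of \<open>G\<close>:
  started there, the potential at time 0 is minimal and no boundary term is lost.
\<close>

subsection \<open>Finite histories\<close>

text \<open>All rewards are deterministic, so randomness sits in transitions and actions alone, and
  a run is a finitely supported law on lists of state-action pairs; the change of measure becomes a
  matter of finite sums. The machine contributes only its \<open>Q - 1\<close> increments to the
  diameter; payments ignore its state. The tree depth being logarithmic, the hypothesis on
  \<open>D\<close> leaves at least half of \<open>D\<close> for the two waiting times, and these
  drive the regret. Paying inner nodes the base gain makes travel neutral: depth affects only the
  gain of the informed policy. The smallest case shapes the constants. Three observation states give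
  a single leaf and two actions give two candidate pairs, so blind play may be right half of the
  time. The informed policy must therefore use the hidden pair clearly more than half of the time,
  which is why waiting at a leaf is made four times as long as waiting in \<open>G\<close>. For
  \<kappa> candidates, \<epsilon> of order \<open>sqrt (\<delta> * \<kappa> / T)\<close> keeps the
  relative entropy small, and \<open>\<epsilon> * T / (\<gamma> + \<delta>)\<close> has the required
  order.\<close>

primrec hist_pmf :: "('x list \<Rightarrow> 'x pmf) \<Rightarrow> nat \<Rightarrow> 'x list pmf" where
  "hist_pmf K 0 = return_pmf []"
| "hist_pmf K (Suc t) = bind_pmf (hist_pmf K t) (\<lambda>l. map_pmf (\<lambda>z. l @ [z]) (K l))"

lemma expectation_bind_finite:
  fixes h :: "'b \<Rightarrow> real"
  assumes "finite (set_pmf p)" "\<And>x. x \<in> set_pmf p \<Longrightarrow> finite (set_pmf (f x))"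
  shows "measure_pmf.expectation (bind_pmf p f) h =
    measure_pmf.expectation p (\<lambda>x. measure_pmf.expectation (f x) h)"
  by (subst pmf_expectation_bind[OF assms(1) assms(2)])
     (auto simp: integral_measure_pmf_real[OF assms(1)] mult.commute intro!: sum.cong)

lemma expectation_finite_mono:
  fixes f g :: "'b \<Rightarrow> real"
  assumes "finite (set_pmf p)" "\<And>x. x \<in> set_pmf p \<Longrightarrow> f x \<le> g x"
  shows "measure_pmf.expectation p f \<le> measure_pmf.expectation p g"
  using assms by (intro integral_mono_AE integrable_measure_pmf_finite AE_pmfI)

lemma length_hist_pmf: "l \<in> set_pmf (hist_pmf K t) \<Longrightarrow> length l = t"
  by (induction t arbitrary: l) auto

lemma finite_hist_pmf:
  "(\<And>l. finite (set_pmf (K l))) \<Longrightarrow> finite (set_pmf (hist_pmf K t))"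
  by (induction t) auto

lemma expectation_hist_pmf_Suc:
  fixes h :: "'x list \<Rightarrow> real"
  assumes "\<And>l. finite (set_pmf (K l))"
  shows "measure_pmf.expectation (hist_pmf K (Suc t)) h =
    measure_pmf.expectation (hist_pmf K t) (\<lambda>l. measure_pmf.expectation (K l) (\<lambda>z. h (l @ [z])))"
  using assms by (simp add: expectation_bind_finite finite_hist_pmf)

text \<open>A nonempty list splits into its front and its last entry in only one way, so one term of
  the mixture survives. This multiplicativity of likelihoods is the source of the chain rule for
  relative entropy.\<close>

lemma pmf_hist_pmf_Suc:
  "pmf (hist_pmf K (Suc t)) (l @ [z]) = pmf (hist_pmf K t) l * pmf (K l) z"
proof -
  have *: "pmf (map_pmf (\<lambda>z. l' @ [z]) (K l')) (l @ [z]) = indicator {l} l' * pmf (K l) z" for l'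
  proof (cases "l' = l")
    case True
    then show ?thesis using pmf_map_inj'[of "\<lambda>z. l @ [z]" "K l" z] by (simp add: inj_def)
  next
    case False
    then have "l @ [z] \<notin> set_pmf (map_pmf (\<lambda>z. l' @ [z]) (K l'))" by auto
    then show ?thesis using False by (simp add: pmf_eq_0_set_pmf)
  qed
  show ?thesis
    by (simp add: pmf_bind * measure_pmf_single)
qed

lemma set_hist_pmf_mono:
  assumes "\<And>l. set_pmf (K l) \<subseteq> set_pmf (K' l)"
  shows "set_pmf (hist_pmf K t) \<subseteq> set_pmf (hist_pmf K' t)"
  using assms by (induction t) (auto, blast)

text \<open>Chain rule for relative entropy, with each conditional entropy replaced by the larger
  chi-square divergence through \<open>ln x \<le> x - 1\<close>. For two-point laws the latter is an
  explicit rational expression.\<close>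

lemma KL_hist_pmf_le:
  fixes K K' :: "'x list \<Rightarrow> 'x pmf"
  assumes fin: "\<And>l. finite (set_pmf (K l))" and supp: "\<And>l. set_pmf (K l) \<subseteq> set_pmf (K' l)"
  shows "measure_pmf.expectation (hist_pmf K T) (\<lambda>l. ln (pmf (hist_pmf K T) l / pmf (hist_pmf K' T) l)) \<le>
    (\<Sum>t<T. measure_pmf.expectation (hist_pmf K t)
      (\<lambda>l. measure_pmf.expectation (K l) (\<lambda>z. pmf (K l) z / pmf (K' l) z) - 1))"
proof (induction T)
  case 0
  then show ?case by simp
next
  case (Suc T)
  let ?P = "hist_pmf K" and ?P' = "hist_pmf K'"
  note finH = finite_hist_pmf[of K, OF fin]
  have "measure_pmf.expectation (?P (Suc T)) (\<lambda>l. ln (pmf (?P (Suc T)) l / pmf (?P' (Suc T)) l)) =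
    measure_pmf.expectation (?P T) (\<lambda>l. measure_pmf.expectation (K l)
      (\<lambda>z. ln (pmf (?P (Suc T)) (l @ [z]) / pmf (?P' (Suc T)) (l @ [z]))))"
    by (rule expectation_hist_pmf_Suc[OF fin])
  also have "\<dots> \<le> measure_pmf.expectation (?P T) (\<lambda>l. ln (pmf (?P T) l / pmf (?P' T) l) +
      (measure_pmf.expectation (K l) (\<lambda>z. pmf (K l) z / pmf (K' l) z) - 1))"
  proof (intro expectation_finite_mono finH)
    fix l assume l: "l \<in> set_pmf (?P T)"
    with set_hist_pmf_mono[of K K' T] supp have l': "l \<in> set_pmf (?P' T)" by blast
    have "measure_pmf.expectation (K l)
        (\<lambda>z. ln (pmf (?P (Suc T)) (l @ [z]) / pmf (?P' (Suc T)) (l @ [z]))) \<le>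
      measure_pmf.expectation (K l)
        (\<lambda>z. ln (pmf (?P T) l / pmf (?P' T) l) + (pmf (K l) z / pmf (K' l) z - 1))"
    proof (intro expectation_finite_mono fin)
      fix z assume z: "z \<in> set_pmf (K l)"
      then have z': "z \<in> set_pmf (K' l)" using supp by blast
      have pos: "0 < pmf (?P T) l / pmf (?P' T) l" "0 < pmf (K l) z / pmf (K' l) z"
        using l l' z z' by (simp_all add: pmf_positive)
      have "pmf (?P (Suc T)) (l @ [z]) / pmf (?P' (Suc T)) (l @ [z]) =
          (pmf (?P T) l / pmf (?P' T) l) * (pmf (K l) z / pmf (K' l) z)"
        by (simp only: pmf_hist_pmf_Suc times_divide_times_eq)
      also have "ln \<dots> = ln (pmf (?P T) l / pmf (?P' T) l) + ln (pmf (K l) z / pmf (K' l) z)"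
        using pos by (intro ln_mult_pos)
      also have "\<dots> \<le> ln (pmf (?P T) l / pmf (?P' T) l) + (pmf (K l) z / pmf (K' l) z - 1)"
        using ln_le_minus_one[OF pos(2)] by simp
      finally show "ln (pmf (?P (Suc T)) (l @ [z]) / pmf (?P' (Suc T)) (l @ [z])) \<le> \<dots>" .
    qed
    also have "\<dots> = ln (pmf (?P T) l / pmf (?P' T) l) +
      (measure_pmf.expectation (K l) (\<lambda>z. pmf (K l) z / pmf (K' l) z) - 1)"
      using fin by (simp add: integrable_measure_pmf_finite)
    finally show "measure_pmf.expectation (K l)
        (\<lambda>z. ln (pmf (?P (Suc T)) (l @ [z]) / pmf (?P' (Suc T)) (l @ [z]))) \<le> \<dots>" .
  qed
  also have "\<dots> = measure_pmf.expectation (?P T) (\<lambda>l. ln (pmf (?P T) l / pmf (?P' T) l)) +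
     measure_pmf.expectation (?P T) (\<lambda>l. measure_pmf.expectation (K l) (\<lambda>z. pmf (K l) z / pmf (K' l) z) - 1)"
    by (intro Bochner_Integration.integral_add integrable_measure_pmf_finite finH)
  finally show ?case using Suc.IH by simp
qed

text \<open>Relative entropy dominates the squared Hellinger distance, which by Cauchy-Schwarz
  dominates the squared total variation up to a constant.\<close>

lemma expectation_diff_le_KL:
  fixes f :: "'x \<Rightarrow> real"
  assumes fin: "finite (set_pmf p)" "finite (set_pmf p')" and supp: "set_pmf p \<subseteq> set_pmf p'"
    and f: "\<And>x. x \<in> set_pmf p' \<Longrightarrow> 0 \<le> f x" "\<And>x. x \<in> set_pmf p' \<Longrightarrow> f x \<le> B"
    and KL: "measure_pmf.expectation p (\<lambda>x. ln (pmf p x / pmf p' x)) \<le> \<kappa>"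
  shows "measure_pmf.expectation p' f \<le> measure_pmf.expectation p f + B * sqrt \<kappa>"
proof -
  let ?X = "set_pmf p'" and ?a = "\<lambda>x. sqrt (pmf p x)" and ?b = "\<lambda>x. sqrt (pmf p' x)"
  have 1: "(\<Sum>x\<in>?X. pmf p x) = 1" "(\<Sum>x\<in>?X. pmf p' x) = 1"
    using fin supp by (simp_all add: sum_pmf_eq_1)
  have E: "measure_pmf.expectation p g = (\<Sum>x\<in>?X. g x * pmf p x)"
    "measure_pmf.expectation p' g = (\<Sum>x\<in>?X. g x * pmf p' x)" for g :: "'x \<Rightarrow> real"
    using fin supp by (intro integral_measure_pmf_real; auto)+
  have sq: "(?b x - ?a x)\<^sup>2 = pmf p' x + pmf p x - 2 * (?a x * ?b x)"
    "(?b x + ?a x)\<^sup>2 = pmf p' x + pmf p x + 2 * (?a x * ?b x)" for x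
    by (simp_all add: power2_diff power2_sum)
  have hell: "(\<Sum>x\<in>?X. (?b x - ?a x)\<^sup>2) \<le> \<kappa>"
  proof -
    have "2 * pmf p x - 2 * (?a x * ?b x) \<le> ln (pmf p x / pmf p' x) * pmf p x" if "x \<in> ?X" for x
    proof (cases "pmf p x = 0")
      case False
      then have pos: "0 < pmf p x" "0 < pmf p' x"
        using that by (simp_all add: pmf_positive pmf_nonneg order_less_le) (auto simp: set_pmf_iff)
      have "?b x / ?a x = sqrt (pmf p' x / pmf p x)" by (simp add: real_sqrt_divide)
      \<comment> \<open>Square roots come first, so that the linear bound on \<open>ln\<close>
        yields the Hellinger affinity instead of a trivial estimate.\<close>
      then have "ln (pmf p x / pmf p' x) = - 2 * ln (?b x / ?a x)"
        using pos by (simp add: ln_sqrt ln_div)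
      moreover have "ln (?b x / ?a x) \<le> ?b x / ?a x - 1"
        using pos by (intro ln_le_minus_one) simp
      ultimately have "ln (pmf p x / pmf p' x) \<ge> 2 - 2 * (?b x / ?a x)" by simp
      then have "(2 - 2 * (?b x / ?a x)) * pmf p x \<le> ln (pmf p x / pmf p' x) * pmf p x"
        using pos by (intro mult_right_mono) auto
      moreover have "?b x / ?a x * pmf p x = ?a x * ?b x"
      proof -
        have "v / u * (u * u) = u * v" if "u \<noteq> 0" for u v :: real using that by simp
        from this[of "?a x" "?b x"] pos show ?thesis by simp
      qed
      ultimately show ?thesis by (simp add: algebra_simps)
    qed simp
    then have "(\<Sum>x\<in>?X. 2 * pmf p x - 2 * (?a x * ?b x)) \<le> (\<Sum>x\<in>?X. ln (pmf p x / pmf p' x) * pmf p x)"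
      by (rule sum_mono)
    also have "\<dots> \<le> \<kappa>" using KL by (simp add: E)
    finally show ?thesis unfolding sq by (simp add: sum_subtractf sum.distrib 1 flip: sum_distrib_left)
  qed
  have four: "(\<Sum>x\<in>?X. (?b x + ?a x)\<^sup>2) \<le> 4"
  proof -
    have "0 \<le> (\<Sum>x\<in>?X. (?b x - ?a x)\<^sup>2)" by (intro sum_nonneg) simp
    then show ?thesis unfolding sq by (simp add: sum_subtractf sum.distrib 1 flip: sum_distrib_left)
  qed
  have tv: "(\<Sum>x\<in>?X. \<bar>pmf p' x - pmf p x\<bar>) \<le> 2 * sqrt \<kappa>"
  proof -
    have "(\<Sum>x\<in>?X. \<bar>pmf p' x - pmf p x\<bar>) = (\<Sum>x\<in>?X. \<bar>?b x - ?a x\<bar> * \<bar>?b x + ?a x\<bar>)"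
    proof (intro sum.cong refl)
      fix x
      have "\<bar>v * v - u * u\<bar> = \<bar>v - u\<bar> * \<bar>v + u\<bar>" for u v :: real
        by (simp add: algebra_simps flip: abs_mult)
      from this[of "?b x" "?a x"] show "\<bar>pmf p' x - pmf p x\<bar> = \<bar>?b x - ?a x\<bar> * \<bar>?b x + ?a x\<bar>"
        by simp
    qed
    also have "\<dots> \<le> sqrt ((\<Sum>x\<in>?X. \<bar>?b x - ?a x\<bar>\<^sup>2) * (\<Sum>x\<in>?X. \<bar>?b x + ?a x\<bar>\<^sup>2))"
      by (intro real_le_rsqrt Cauchy_Schwarz_ineq_sum)
    also have "\<dots> \<le> sqrt (\<kappa> * 4)"
      using hell four by (intro real_sqrt_le_mono mult_mono) (auto intro!: sum_nonneg order_trans[OF _ hell])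
    finally show ?thesis by (simp add: real_sqrt_mult)
  qed
  have B: "0 \<le> B" using f set_pmf_not_empty[of p'] by (meson all_not_in_conv order_trans)
  \<comment> \<open>Both laws have mass 1, so \<open>f\<close> may be centred at
    \<open>B / 2\<close>; this halves the factor in front of the \<open>L1\<close> distance.\<close>
  have "measure_pmf.expectation p' f - measure_pmf.expectation p f =
      (\<Sum>x\<in>?X. (f x - B / 2) * (pmf p' x - pmf p x))"
    by (simp add: E algebra_simps sum_subtractf sum.distrib 1 flip: sum_distrib_left sum_divide_distrib)
  also have "\<dots> \<le> (\<Sum>x\<in>?X. B / 2 * \<bar>pmf p' x - pmf p x\<bar>)"
  proof (intro sum_mono)
    fix x assume "x \<in> ?X"
    with f have "\<bar>f x - B / 2\<bar> \<le> B / 2" by (force simp: abs_le_iff field_simps)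
    then have "\<bar>f x - B / 2\<bar> * \<bar>pmf p' x - pmf p x\<bar> \<le> B / 2 * \<bar>pmf p' x - pmf p x\<bar>"
      by (rule mult_right_mono) simp
    then show "(f x - B / 2) * (pmf p' x - pmf p x) \<le> B / 2 * \<bar>pmf p' x - pmf p x\<bar>"
      by (simp add: abs_le_iff flip: abs_mult)
  qed
  also have "\<dots> = B / 2 * (\<Sum>x\<in>?X. \<bar>pmf p' x - pmf p x\<bar>)" by (simp only: sum_distrib_left)
  also have "\<dots> \<le> B / 2 * (2 * sqrt \<kappa>)" using tv B by (intro mult_left_mono) auto
  finally show ?thesis by simp
qed

subsection \<open>Trajectories of processes with deterministic rewards\<close>

text \<open>Rebuilds the extensional history that a decision rule reads. Rewards are not recorded in
  the list, being functions of the pair.\<close>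

definition det_hist :: "('s \<Rightarrow> 'a \<Rightarrow> real) \<Rightarrow> nat \<Rightarrow> ('s \<times> 'a) list \<Rightarrow> nat \<Rightarrow> 's \<times> 'a \<times> real" where
  "det_hist R t l = (\<lambda>i\<in>{0..<t}. (fst (l ! i), snd (l ! i), R (fst (l ! i)) (snd (l ! i))))"

definition det_kernel :: "('s, 'a) mdp \<Rightarrow> ('s \<Rightarrow> 'a \<Rightarrow> real) \<Rightarrow>
    (nat \<Rightarrow> (nat \<Rightarrow> 's \<times> 'a \<times> real) \<Rightarrow> 's \<Rightarrow> 'a pmf) \<Rightarrow> 's \<Rightarrow> ('s \<times> 'a) list \<Rightarrow> ('s \<times> 'a) pmf" where
  "det_kernel N R \<pi> s\<^sub>1 l = choice_pmf N \<pi> s\<^sub>1 (length l) (det_hist R (length l) l)"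

lemma space_step_space: "space step_space = UNIV"
  by (simp add: step_space_def space_pair_measure)

lemma measurable_det_hist:
  "det_hist R t \<in> measurable (measure_pmf p) (PiM {0..<t} (\<lambda>_. step_space))"
  by (auto simp: measurable_def det_hist_def space_PiM space_step_space)

text \<open>\<open>A\<close> may exceed the action set of \<open>N\<close>, because stationary
  policies carry a default value outside the states. Finiteness of \<open>A\<close> and of the
  transition supports makes every \<open>H t\<close> finitely supported.\<close>

locale det_mdp =
  fixes N :: "('s::countable, 'a::countable) mdp" and R :: "'s \<Rightarrow> 'a \<Rightarrow> real"
    and A :: "'a set"
    and \<pi> :: "nat \<Rightarrow> (nat \<Rightarrow> 's \<times> 'a \<times> real) \<Rightarrow> 's \<Rightarrow> 'a pmf" and s\<^sub>1 :: 's
  assumes reward: "\<And>s a. mdp_reward N s a = return borel (R s a)"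
    and rule: "decision_rule step_space A \<pi>"
    and finite_A: "finite A"
    and finite_trans: "\<And>s a. finite (set_pmf (mdp_trans N s a))"
begin

abbreviation "K \<equiv> det_kernel N R \<pi> s\<^sub>1"
abbreviation "H \<equiv> hist_pmf K"
abbreviation "traj \<equiv> trajectory N \<pi> s\<^sub>1"

lemma
  shows prob_space_traj: "prob_space traj"
    and sets_traj: "sets traj = sets (PiM UNIV (\<lambda>_. step_space))"
  using prob_space_trajectory[of N A \<pi> s\<^sub>1] rule by (simp_all add: reward prob_space_return)

lemma step_kernel_det:
  "step_kernel N \<pi> s\<^sub>1 t h =
    distr (choice_pmf N \<pi> s\<^sub>1 t h) step_space (\<lambda>z. (fst z, snd z, R (fst z) (snd z)))"
proof -
  have "(\<lambda>r. (s, a, r)) \<in> measurable borel step_space" for s :: 's and a :: 'a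
    unfolding step_space_def by measurable
  then have "(\<lambda>(s, a). distr (mdp_reward N s a) step_space (\<lambda>r. (s, a, r))) =
      (\<lambda>z. return step_space (fst z, snd z, R (fst z) (snd z)))"
    by (auto simp: reward distr_return)
  then show ?thesis
    unfolding step_kernel_def
    by (simp add: bind_return_distr' measurable_def space_step_space)
qed

text \<open>Induction along the Ionescu-Tulcea composition: an extension kernel adds one round,
  which on lists is appending one pair.\<close>

lemma distr_trajectory_det:
  "distr traj (PiM {0..<t} (\<lambda>_. step_space)) (\<lambda>\<omega>. restrict \<omega> {0..<t}) =
   distr (H t) (PiM {0..<t} (\<lambda>_. step_space)) (det_hist R t)"
proof -
  interpret IT: Ionescu_Tulcea "step_kernel N \<pi> s\<^sub>1" "\<lambda>_. step_space"
    by (rule Ionescu_Tulcea_step_kernel[OF _ _ rule]) (simp_all add: reward prob_space_return)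
  let ?P = "\<lambda>t. PiM {0..<t} (\<lambda>_. step_space) :: (nat \<Rightarrow> 's \<times> 'a \<times> real) measure"
  have dh: "det_hist R t l \<in> space (?P t)" for t l
    by (auto simp: det_hist_def space_PiM space_step_space)
  have C: "IT.C 0 t (\<lambda>_. undefined) = distr (H t) (?P t) (det_hist R t)" for t
  proof (induction t)
    case 0
    show ?case
      by (rule measure_eqI) (auto simp: emeasure_distr measurable_det_hist det_hist_def restrict_def)
  next
    case (Suc t)
    have "IT.C 0 (Suc t) (\<lambda>_. undefined) = distr (H t) (?P t) (det_hist R t) \<bind> IT.eP t"
      using Suc by simp
    also have "\<dots> = measure_pmf (H t) \<bind> (\<lambda>l. IT.eP t (det_hist R t l))"
      by (rule bind_distr[OF measurable_det_hist IT.measurable_eP]) simp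
    also have "\<dots> = measure_pmf (H t) \<bind>
        (\<lambda>l. distr (map_pmf (\<lambda>z. l @ [z]) (K l)) (?P (Suc t)) (det_hist R (Suc t)))"
    proof (rule bind_measure_pmf_cong[where N="?P (Suc t)"])
      show "IT.eP t (det_hist R t l) \<in> space (subprob_algebra (?P (Suc t)))" for l
        using IT.measurable_eP[of t] dh by (rule measurable_space)
      show "distr (map_pmf (\<lambda>z. l @ [z]) (K l)) (?P (Suc t)) (det_hist R (Suc t))
          \<in> space (subprob_algebra (?P (Suc t)))" for l
        by (auto simp: space_subprob_algebra intro!: prob_space_imp_subprob_space
            measure_pmf.prob_space_distr measurable_det_hist)
    next
      fix l assume "l \<in> set_pmf (H t)"
      then have l: "length l = t" by (rule length_hist_pmf)
      have "IT.eP t (det_hist R t l) = distr (distr (K l) step_space (\<lambda>z. (fst z, snd z, R (fst z) (snd z))))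
          (?P (Suc t)) (fun_upd (det_hist R t l) t)"
        by (simp add: IT.eP_def step_kernel_det det_kernel_def l)
      also have "\<dots> = distr (K l) (?P (Suc t)) (fun_upd (det_hist R t l) t \<circ> (\<lambda>z. (fst z, snd z, R (fst z) (snd z))))"
      proof (rule distr_distr)
        show "fun_upd (det_hist R t l) t \<in> measurable step_space (?P (Suc t))"
          using dh[of t l] by (intro measurable_fun_upd[where J="{0..<t}"]) auto
      qed (simp add: measurable_def space_step_space)
      also have "fun_upd (det_hist R t l) t \<circ> (\<lambda>z. (fst z, snd z, R (fst z) (snd z))) =
          det_hist R (Suc t) \<circ> (\<lambda>z. l @ [z])"
        using l by (auto simp: fun_eq_iff det_hist_def nth_append)
      also have "distr (K l) (?P (Suc t)) \<dots> =
          distr (map_pmf (\<lambda>z. l @ [z]) (K l)) (?P (Suc t)) (det_hist R (Suc t))"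
        unfolding map_pmf_rep_eq
        by (subst distr_distr) (auto simp: measurable_def det_hist_def space_PiM space_step_space)
      finally show "IT.eP t (det_hist R t l) = \<dots>" .
    qed
    also have "\<dots> = distr (H (Suc t)) (?P (Suc t)) (det_hist R (Suc t))"
      unfolding hist_pmf.simps measure_pmf_bind
      by (subst distr_bind[where K="count_space UNIV"])
         (auto simp: measurable_def det_hist_def space_PiM space_step_space space_subprob_algebra
           measure_pmf.subprob_space_axioms)
    finally show ?case .
  qed
  \<comment> \<open>The limit measure is described on a finite index set through the shortest
    initial segment that contains it.\<close>
  have up: "IT.up_to {0..<t} = t"
    using IT.up_to_less[of "{0..<t}" "IT.up_to {0..<t}"]
    by (intro antisym) (force simp: IT.up_to_iff_Ico)+
  have "distr traj (?P t) (\<lambda>\<omega>. restrict \<omega> {0..<t}) = IT.CI {0..<t}"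
    unfolding trajectory_def by (rule IT.distr_lim) simp
  also have "\<dots> = distr (distr (H t) (?P t) (det_hist R t)) (?P t) (\<lambda>f. restrict f {0..<t})"
    unfolding IT.CI_def up C ..
  also have "\<dots> = distr (H t) (?P t) (det_hist R t)"
  proof -
    have "(\<lambda>f. restrict f {0..<t}) \<circ> det_hist R t = det_hist R t"
      by (auto simp: fun_eq_iff det_hist_def)
    then show ?thesis
      by (subst distr_distr[OF measurable_restrict_subset[OF subset_refl] measurable_det_hist]) simp
  qed
  finally show ?thesis .
qed

lemma measurable_restrict_traj:
  "(\<lambda>\<omega>. restrict \<omega> {0..<t}) \<in> measurable traj (PiM {0..<t} (\<lambda>_. step_space))"
  by (simp add: measurable_cong_sets[OF sets_traj refl] measurable_restrict_subset)

lemma finite_K: "finite (set_pmf (K l))"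
proof -
  have "finite (set_pmf (\<pi> t h s))" for t h s
    using rule finite_A unfolding decision_rule_def by (meson finite_subset)
  then show ?thesis
    using finite_trans by (auto simp: det_kernel_def choice_pmf_def)
qed

lemmas finite_H = finite_hist_pmf[of K, OF finite_K]
lemmas expectation_H_Suc = expectation_hist_pmf_Suc[of K, OF finite_K]

lemma
  shows integrable_total_reward: "integrable traj (total_reward T)"
    and expectation_total_reward: "(\<integral>\<omega>. total_reward T \<omega> \<partial>traj) =
      measure_pmf.expectation (H T) (\<lambda>l. \<Sum>(s, a)\<leftarrow>l. R s a)"
proof -
  let ?P = "PiM {0..<T} (\<lambda>_. step_space) :: (nat \<Rightarrow> 's \<times> 'a \<times> real) measure"
  let ?F = "\<lambda>h. \<Sum>t<T. snd (snd (h t)) :: real"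
  have [measurable]: "(\<lambda>x. snd (snd x)) \<in> borel_measurable (step_space :: ('s \<times> 'a \<times> real) measure)"
    unfolding step_space_def by measurable
  have F: "?F \<in> borel_measurable ?P"
    by (intro borel_measurable_sum measurable_compose[OF measurable_component_singleton]) auto
  have F1: "?F (restrict \<omega> {0..<T}) = total_reward T \<omega>" for \<omega>
    by (simp add: total_reward_def)
  have F2: "?F (det_hist R T l) = (\<Sum>(s, a)\<leftarrow>l. R s a)" if "l \<in> set_pmf (H T)" for l
    using length_hist_pmf[OF that]
    by (simp add: det_hist_def sum_list_sum_nth atLeast0LessThan case_prod_beta)
  have "integrable (H T) (\<lambda>l. ?F (det_hist R T l))"
    by (rule integrable_measure_pmf_finite[OF finite_H])
  then have "integrable (distr (H T) ?P (det_hist R T)) ?F"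
    by (simp only: integrable_distr_eq[OF measurable_det_hist F])
  then have "integrable traj (\<lambda>\<omega>. ?F (restrict \<omega> {0..<T}))"
    by (subst integrable_distr_eq[symmetric, OF measurable_restrict_traj F])
       (simp add: distr_trajectory_det)
  then show "integrable traj (total_reward T)"
    by (simp only: F1)
  have "(\<integral>\<omega>. total_reward T \<omega> \<partial>traj) = (\<integral>\<omega>. ?F (restrict \<omega> {0..<T}) \<partial>traj)"
    by (simp only: F1)
  also have "\<dots> = integral\<^sup>L (distr (H T) ?P (det_hist R T)) ?F"
    by (subst integral_distr[OF measurable_restrict_traj F, symmetric]) (simp add: distr_trajectory_det)
  also have "\<dots> = measure_pmf.expectation (H T) (\<lambda>l. ?F (det_hist R T l))"
    by (rule integral_distr[OF measurable_det_hist F])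
  also have "\<dots> = measure_pmf.expectation (H T) (\<lambda>l. \<Sum>(s, a)\<leftarrow>l. R s a)"
    by (intro integral_cong_AE AE_pmfI) (auto simp: F2)
  finally show "(\<integral>\<omega>. total_reward T \<omega> \<partial>traj) = \<dots>" .
qed

lemma
  shows measurable_no_hit: "{\<omega> \<in> space traj. \<forall>i<t. fst (\<omega> i) \<noteq> s'} \<in> sets traj"
    and emeasure_no_hit: "emeasure traj {\<omega> \<in> space traj. \<forall>i<t. fst (\<omega> i) \<noteq> s'} =
      ennreal (measure_pmf.prob (H t) {l. s' \<notin> fst ` set l})"
proof -
  let ?P = "PiM {0..<t} (\<lambda>_. step_space) :: (nat \<Rightarrow> 's \<times> 'a \<times> real) measure"
  have [measurable]: "fst \<in> measurable (step_space :: ('s \<times> 'a \<times> real) measure) (count_space UNIV)"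
    unfolding step_space_def by measurable
  let ?B = "{h \<in> space ?P. \<forall>i\<in>{..<t}. fst (h i) \<noteq> s'}"
  have "(\<lambda>h. fst (h i)) \<in> measurable ?P (count_space UNIV)" if "i < t" for i
    using that by (intro measurable_compose[OF measurable_component_singleton]) auto
  from measurable_sets[OF this, of _ "- {s'}"] have B: "?B \<in> sets ?P"
    by (intro sets.sets_Collect_finite_All finite_lessThan) (auto simp: vimage_def Int_def conj_commute)
  have eq: "{\<omega> \<in> space traj. \<forall>i<t. fst (\<omega> i) \<noteq> s'} = (\<lambda>\<omega>. restrict \<omega> {0..<t}) -` ?B \<inter> space traj"
    using measurable_space[OF measurable_restrict_traj] by auto
  show "{\<omega> \<in> space traj. \<forall>i<t. fst (\<omega> i) \<noteq> s'} \<in> sets traj"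
    unfolding eq by (rule measurable_sets[OF measurable_restrict_traj B])
  have "emeasure traj {\<omega> \<in> space traj. \<forall>i<t. fst (\<omega> i) \<noteq> s'} =
      emeasure (distr (H t) ?P (det_hist R t)) ?B"
    unfolding eq by (subst emeasure_distr[OF measurable_restrict_traj B, symmetric])
       (simp add: distr_trajectory_det)
  also have "\<dots> = emeasure (H t) (det_hist R t -` ?B)"
    by (simp only: emeasure_distr[OF measurable_det_hist B] space_measure_pmf Int_UNIV_right)
  also have "\<dots> = emeasure (H t) {l. s' \<notin> fst ` set l}"
  proof (intro emeasure_eq_AE AE_pmfI)
    fix l assume "l \<in> set_pmf (H t)"
    then have "length l = t" by (rule length_hist_pmf)
    then show "l \<in> det_hist R t -` ?B \<longleftrightarrow> l \<in> {l. s' \<notin> fst ` set l}"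
      using in_set_conv_nth[of s' "map fst l"]
      by (auto simp: det_hist_def space_PiM space_step_space)
  qed auto
  finally show "emeasure traj {\<omega> \<in> space traj. \<forall>i<t. fst (\<omega> i) \<noteq> s'} =
      ennreal (measure_pmf.prob (H t) {l. s' \<notin> fst ` set l})"
    by (simp add: measure_pmf.emeasure_eq_measure)
qed

text \<open>Tail-sum formula: the time counts the \<open>t\<close> for which rounds
  \<open>0, ..., t\<close> all avoid \<open>s'\<close>. A path that never hits gives infinity on
  both sides, the infimum being over the empty set.\<close>

lemma hitting_time_suminf:
  "hitting_time s' \<omega> = (\<Sum>t. indicator {\<omega>. \<forall>i<Suc t. fst (\<omega> i) \<noteq> s'} \<omega>)"
proof (cases "\<exists>t. fst (\<omega> t) = s'")
  case False
  then show ?thesis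
    by (simp add: hitting_time_def suminf_eq_SUP ennreal_SUP_of_nat_eq_top)
next
  case True
  define \<tau> where "\<tau> = (LEAST t. fst (\<omega> t) = s')"
  have \<tau>: "fst (\<omega> \<tau>) = s'" using True unfolding \<tau>_def by (rule LeastI_ex)
  have least: "\<tau> \<le> t" if "fst (\<omega> t) = s'" for t using that unfolding \<tau>_def by (rule Least_le)
  have ind: "indicator {\<omega>. \<forall>i<Suc t. fst (\<omega> i) \<noteq> s'} \<omega> = (if t < \<tau> then 1 else 0 :: ennreal)" for t
  proof -
    have "(\<forall>i<Suc t. fst (\<omega> i) \<noteq> s') \<longleftrightarrow> t < \<tau>"
      using \<tau> least by (metis le_less_trans less_Suc_eq_le not_le)
    then show ?thesis by (simp add: indicator_def)
  qed
  have "(\<Sum>t. if t < \<tau> then 1 else 0 :: ennreal) = (\<Sum>t<\<tau>. 1)"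
    by (subst suminf_finite[where N="{..<\<tau>}"]) auto
  moreover have "hitting_time s' \<omega> = of_nat \<tau>"
    unfolding hitting_time_def using \<tau> least
    by (intro antisym INF_lower2[of \<tau>] INF_greatest) auto
  ultimately show ?thesis by (simp add: ind)
qed

lemma nn_integral_hitting_time:
  "(\<integral>\<^sup>+ \<omega>. hitting_time s' \<omega> \<partial>traj) =
   (\<Sum>t. ennreal (measure_pmf.prob (H (Suc t)) {l. s' \<notin> fst ` set l}))"
proof -
  let ?B = "\<lambda>t. {\<omega> \<in> space traj. \<forall>i<Suc t. fst (\<omega> i) \<noteq> s'}"
  have "(\<integral>\<^sup>+ \<omega>. hitting_time s' \<omega> \<partial>traj) = (\<integral>\<^sup>+ \<omega>. (\<Sum>t. indicator (?B t) \<omega>) \<partial>traj)"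
    unfolding hitting_time_suminf by (intro nn_integral_cong suminf_cong) (auto simp: indicator_def)
  also have "\<dots> = (\<Sum>t. \<integral>\<^sup>+ \<omega>. indicator (?B t) \<omega> \<partial>traj)"
    using measurable_no_hit by (intro nn_integral_suminf borel_measurable_indicator) 
  also have "\<dots> = (\<Sum>t. emeasure traj (?B t))"
    using measurable_no_hit by (intro suminf_cong nn_integral_indicator)
  finally show ?thesis by (simp only: emeasure_no_hit)
qed

end

subsection \<open>Potential functions\<close>

text \<open>\<open>Act s\<close> is a singleton for a stationary policy, so that drift conditions
  concern its action only, and the whole action set for an arbitrary learner. In this context
  \<open>'a\<close> is the type of states and \<open>'b\<close> that of actions.\<close>

locale confined_mdp = det_mdp +
  fixes S :: "'a set" and Act :: "'a \<Rightarrow> 'b set"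
  assumes start: "s\<^sub>1 \<in> S"
    and Act: "\<And>t h s. set_pmf (\<pi> t h s) \<subseteq> Act s"
    and closed: "\<And>s a. s \<in> S \<Longrightarrow> a \<in> Act s \<Longrightarrow> set_pmf (mdp_trans N s a) \<subseteq> S"
begin

abbreviation "next_pmf l \<equiv> (if l = [] then return_pmf s\<^sub>1 else mdp_trans N (fst (last l)) (snd (last l)))"

lemma K_eq: "K l = bind_pmf (next_pmf l)
    (\<lambda>s. map_pmf (Pair s) (\<pi> (length l) (det_hist R (length l) l) s))"
  by (cases l rule: rev_cases) (simp_all add: det_kernel_def choice_pmf_def det_hist_def)

lemma map_fst_K: "map_pmf fst (K l) = next_pmf l"
  by (simp add: K_eq map_bind_pmf pmf.map_comp comp_def map_pmf_const bind_return_pmf')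

lemma expectation_fst_K:
  fixes f :: "'a \<Rightarrow> real"
  shows "measure_pmf.expectation (K l) (\<lambda>z. f (fst z)) = measure_pmf.expectation (next_pmf l) f"
  by (subst map_fst_K[symmetric]) simp

text \<open>The newest state is drawn before the newest action, so a quantity that ignores this
  action is averaged over the transition alone.\<close>

lemma expectation_last_H:
  fixes g :: "('a \<times> 'b) list \<Rightarrow> 'a \<Rightarrow> real"
  shows "measure_pmf.expectation (H (Suc t)) (\<lambda>l. g (butlast l) (fst (last l))) =
    measure_pmf.expectation (H t) (\<lambda>l. measure_pmf.expectation (next_pmf l) (g l))"
  unfolding expectation_H_Suc butlast_snoc last_snoc by (subst expectation_fst_K) rule

lemma set_H: "l \<in> set_pmf (H t) \<Longrightarrow> z \<in> set l \<Longrightarrow> fst z \<in> S \<and> snd z \<in> Act (fst z)"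
proof (induction t arbitrary: l z)
  case 0
  then show ?case by simp
next
  case (Suc t)
  then obtain l' z' where l': "l' \<in> set_pmf (H t)" "z' \<in> set_pmf (K l')" "l = l' @ [z']" by auto
  have "set_pmf (next_pmf l') \<subseteq> S"
    using start closed Suc.IH[OF l'(1), of "last l'"] by auto
  then have "fst z' \<in> S \<and> snd z' \<in> Act (fst z')"
    using l'(2) Act by (fastforce simp: K_eq split del: if_split)
  then show ?case using Suc.IH[OF l'(1), of z] Suc.prems(2) l'(3) by auto
qed

lemma last_H:
  assumes "l \<in> set_pmf (H (Suc t))"
  shows "l \<noteq> []" "fst (last l) \<in> S" "snd (last l) \<in> Act (fst (last l))"
proof -
  show ne: "l \<noteq> []" using length_hist_pmf[OF assms] by auto
  show "fst (last l) \<in> S" "snd (last l) \<in> Act (fst (last l))"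
    using set_H[OF assms, of "last l"] ne by auto
qed

text \<open>Accumulated \<open>f\<close> plus current potential is a supermartingale. The state
  reached after \<open>T\<close> rounds is the last one in a history of length \<open>Suc T\<close>,
  where its action is not yet charged; hence the shift.\<close>

lemma potential_sum_le:
  assumes f: "\<And>s a. s \<in> S \<Longrightarrow> a \<in> Act s \<Longrightarrow>
    f (s, a) + measure_pmf.expectation (mdp_trans N s a) h \<le> (h s :: real)"
  shows "measure_pmf.expectation (H T) (\<lambda>l. \<Sum>z\<leftarrow>l. f z) +
    measure_pmf.expectation (H (Suc T)) (\<lambda>l. h (fst (last l))) \<le> h s\<^sub>1"
proof (induction T)
  case 0
  show ?case by (subst expectation_last_H[where g="\<lambda>_. h"]) simp
next
  case (Suc T)
  let ?E = "measure_pmf.expectation"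
  note int = integrable_measure_pmf_finite[OF finite_H]
  have "?E (H (Suc T)) (\<lambda>l. \<Sum>z\<leftarrow>l. f z) + ?E (H (Suc (Suc T))) (\<lambda>l. h (fst (last l))) =
      ?E (H (Suc T)) (\<lambda>l. \<Sum>z\<leftarrow>l. f z) + ?E (H (Suc T)) (\<lambda>l. ?E (next_pmf l) h)"
    by (subst expectation_last_H[where g="\<lambda>_. h"]) rule
  also have "\<dots> = ?E (H (Suc T)) (\<lambda>l. (\<Sum>z\<leftarrow>l. f z) + ?E (next_pmf l) h)"
    by (rule Bochner_Integration.integral_add[symmetric, OF int int])
  also have "\<dots> \<le> ?E (H (Suc T)) (\<lambda>l. (\<Sum>z\<leftarrow>butlast l. f z) + h (fst (last l)))"
  proof (intro expectation_finite_mono finite_H)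
    fix l assume l: "l \<in> set_pmf (H (Suc T))"
    have "(\<Sum>z\<leftarrow>l. f z) = (\<Sum>z\<leftarrow>butlast l. f z) + f (last l)"
      using last_H(1)[OF l] by (subst append_butlast_last_id[symmetric]) (auto simp del: append_butlast_last_id)
    then show "(\<Sum>z\<leftarrow>l. f z) + ?E (next_pmf l) h \<le> (\<Sum>z\<leftarrow>butlast l. f z) + h (fst (last l))"
      using f[of "fst (last l)" "snd (last l)"] last_H[OF l] by simp
  qed
  also have "\<dots> = ?E (H T) (\<lambda>l. \<Sum>z\<leftarrow>l. f z) + ?E (H (Suc T)) (\<lambda>l. h (fst (last l)))"
    unfolding Bochner_Integration.integral_add[OF int int]
    by (subst expectation_last_H[where g="\<lambda>l _. \<Sum>z\<leftarrow>l. f z"]) simp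
  also note Suc.IH
  finally show ?case .
qed

section \<open>Expected hitting times through stopped potentials\<close>

definition survive :: "'a \<Rightarrow> nat \<Rightarrow> real" where
  "survive s' t = measure_pmf.prob (H (Suc t)) {l. s' \<notin> fst ` set l}"

definition stopped :: "'a \<Rightarrow> ('a \<Rightarrow> real) \<Rightarrow> nat \<Rightarrow> real" where
  "stopped s' V t = measure_pmf.expectation (H (Suc t))
    (\<lambda>l. indicator {l. s' \<notin> fst ` set l} l * V (fst (last l)))"

text \<open>As \<open>V\<close> vanishes at \<open>s'\<close>, it is immaterial whether the
  indicator inspects the newest state. Evaluated one round earlier it depends on the past only and
  can be pulled out of the transition.\<close>

lemma stopped_step:
  assumes "V s' = 0"
  shows "stopped s' V (Suc t) = measure_pmf.expectation (H (Suc t)) (\<lambda>l. indicator {l. s' \<notin> fst ` set l} l *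
    measure_pmf.expectation (mdp_trans N (fst (last l)) (snd (last l))) V)"
    and "stopped s' V 0 = V s\<^sub>1"
proof -
  let ?g = "\<lambda>l x. indicator {l. s' \<notin> fst ` set l} l * V x"
  have *: "indicator {l. s' \<notin> fst ` set l} l * V (fst (last l)) = ?g (butlast l) (fst (last l))"
    if "l \<noteq> []" for l :: "('a \<times> 'b) list"
    using that assms by (cases l rule: rev_cases) (auto simp: indicator_def)
  have **: "stopped s' V t' = measure_pmf.expectation (H t') (\<lambda>l. indicator {l. s' \<notin> fst ` set l} l *
      measure_pmf.expectation (next_pmf l) V)" for t'
  proof -
    have "stopped s' V t' = measure_pmf.expectation (H (Suc t')) (\<lambda>l. ?g (butlast l) (fst (last l)))"
      unfolding stopped_def by (intro integral_cong_AE AE_pmfI *[OF last_H(1)]) auto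
    also have "\<dots> = measure_pmf.expectation (H t') (\<lambda>l. measure_pmf.expectation (next_pmf l) (?g l))"
      by (rule expectation_last_H)
    finally show ?thesis by (simp only: integral_mult_right_zero)
  qed
  show "stopped s' V 0 = V s\<^sub>1" unfolding ** by simp
  show "stopped s' V (Suc t) = measure_pmf.expectation (H (Suc t)) (\<lambda>l. indicator {l. s' \<notin> fst ` set l} l *
    measure_pmf.expectation (mdp_trans N (fst (last l)) (snd (last l))) V)"
    unfolding ** by (intro integral_cong_AE AE_pmfI) (auto simp: last_H(1) simp del: hist_pmf.simps)
qed

lemma survive_nonneg: "0 \<le> survive s' t"
  unfolding survive_def by (rule measure_nonneg)

lemma survive_eq: "survive s' t = measure_pmf.expectation (H (Suc t)) (\<lambda>l. indicator {l. s' \<notin> fst ` set l} l)"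
  unfolding survive_def by simp

text \<open>Lyapunov bound: in each round the stopped potential drops on average by at least the
  survival probability, so these probabilities telescope below \<open>V s\<^sub>1\<close>, the
  remainder being nonnegative.\<close>

lemma hitting_time_le:
  assumes V: "V s' = 0" "\<And>s. s \<in> S \<Longrightarrow> 0 \<le> V s"
    and step: "\<And>s a. s \<in> S \<Longrightarrow> a \<in> Act s \<Longrightarrow> s \<noteq> s' \<Longrightarrow>
      1 + measure_pmf.expectation (mdp_trans N s a) V \<le> V s"
  shows "(\<integral>\<^sup>+ \<omega>. hitting_time s' \<omega> \<partial>traj) \<le> ennreal (V s\<^sub>1)"
proof -
  let ?I = "\<lambda>l :: ('a \<times> 'b) list. indicator {l. s' \<notin> fst ` set l} l :: real"
  note int = integrable_measure_pmf_finite[OF finite_H]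
  define w where "w = stopped s' V"
  note w = stopped_step[of V s', OF V(1), folded w_def]
  have w0: "0 \<le> w t" for t
    unfolding w_def stopped_def using V(2) last_H(2)
    by (intro Bochner_Integration.integral_nonneg_AE AE_pmfI) (auto simp del: hist_pmf.simps)
  have "survive s' t + w (Suc t) \<le> w t" for t
  proof -
    have "survive s' t + w (Suc t) = measure_pmf.expectation (H (Suc t)) (\<lambda>l. ?I l + ?I l *
        measure_pmf.expectation (mdp_trans N (fst (last l)) (snd (last l))) V)"
      unfolding survive_eq w
      by (rule Bochner_Integration.integral_add[symmetric, OF int int])
    also have "\<dots> \<le> w t"
      unfolding w_def stopped_def
    proof (intro expectation_finite_mono finite_H)
      fix l assume l: "l \<in> set_pmf (H (Suc t))"
      show "?I l + ?I l * measure_pmf.expectation (mdp_trans N (fst (last l)) (snd (last l))) V \<le>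
          ?I l * V (fst (last l))"
        using step[OF last_H(2,3)[OF l]] imageI[OF last_in_set[OF last_H(1)[OF l]], of fst]
        by (auto simp: indicator_def)
    qed
    finally show ?thesis .
  qed
  then have "(\<Sum>t<n. survive s' t) + w n \<le> V s\<^sub>1" for n
  proof (induction n)
    case (Suc n)
    then show ?case using Suc.prems[of n] by fastforce
  qed (simp add: w(2))
  then have bd: "(\<Sum>t<n. survive s' t) \<le> V s\<^sub>1" for n
    using w0[of n] by (smt (verit))
  have "(\<Sum>t<n. ennreal (survive s' t)) \<le> ennreal (V s\<^sub>1)" for n
    using bd[of n] by (subst sum_ennreal) (auto simp: survive_nonneg intro: ennreal_leI)
  then show ?thesis
    unfolding nn_integral_hitting_time survive_def[symmetric]
    by (intro suminf_le_const) auto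
qed

text \<open>The reverse telescoping leaves a remainder of at most \<open>B\<close> times the
  survival probability. It vanishes if the tails are summable; otherwise the expected time is
  infinite.\<close>

lemma hitting_time_ge:
  assumes V: "V s' = 0" "\<And>s. s \<in> S \<Longrightarrow> V s \<le> B"
    and step: "\<And>s a. s \<in> S \<Longrightarrow> a \<in> Act s \<Longrightarrow> s \<noteq> s' \<Longrightarrow>
      V s \<le> 1 + measure_pmf.expectation (mdp_trans N s a) V"
  shows "ennreal (V s\<^sub>1) \<le> (\<integral>\<^sup>+ \<omega>. hitting_time s' \<omega> \<partial>traj)"
proof (cases "summable (survive s')")
  case False
  have "(\<Sum>t. ennreal (survive s' t)) = top"
    using False summable_suminf_not_top[of "survive s'"] survive_nonneg by blast
  then show ?thesis
    unfolding nn_integral_hitting_time survive_def[symmetric] by simp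
next
  case True
  let ?I = "\<lambda>l :: ('a \<times> 'b) list. indicator {l. s' \<notin> fst ` set l} l :: real"
  note int = integrable_measure_pmf_finite[OF finite_H]
  define w where "w = stopped s' V"
  note w = stopped_step[of V s', OF V(1), folded w_def]
  have wB: "w t \<le> B * survive s' t" for t
    unfolding w_def stopped_def survive_eq integral_mult_right_zero[symmetric] using V(2) last_H(2)
    by (intro expectation_finite_mono finite_H) (auto simp: indicator_def simp del: hist_pmf.simps)
  have "w t \<le> survive s' t + w (Suc t)" for t
  proof -
    have "w t \<le> measure_pmf.expectation (H (Suc t)) (\<lambda>l. ?I l + ?I l *
        measure_pmf.expectation (mdp_trans N (fst (last l)) (snd (last l))) V)"
      unfolding w_def stopped_def
    proof (intro expectation_finite_mono finite_H)
      fix l assume l: "l \<in> set_pmf (H (Suc t))"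
      show "?I l * V (fst (last l)) \<le>
          ?I l + ?I l * measure_pmf.expectation (mdp_trans N (fst (last l)) (snd (last l))) V"
        using step[OF last_H(2,3)[OF l]] imageI[OF last_in_set[OF last_H(1)[OF l]], of fst]
        by (auto simp: indicator_def)
    qed
    also have "\<dots> = survive s' t + w (Suc t)"
      unfolding survive_eq w
      by (rule Bochner_Integration.integral_add[OF int int])
    finally show ?thesis .
  qed
  then have "V s\<^sub>1 \<le> (\<Sum>t<n. survive s' t) + w n" for n
  proof (induction n)
    case (Suc n)
    then show ?case using Suc.prems[of n] by fastforce
  qed (simp add: w(2))
  then have bd: "V s\<^sub>1 \<le> (\<Sum>t<n. survive s' t) + B * survive s' n" for n
    using wB[of n] by (smt (verit))
  have "(\<lambda>n. (\<Sum>t<n. survive s' t) + B * survive s' n) \<longlonglongrightarrow> suminf (survive s') + B * 0"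
    using True by (intro tendsto_intros summable_LIMSEQ summable_LIMSEQ_zero)
  then have "V s\<^sub>1 \<le> suminf (survive s')"
    using bd by (intro LIMSEQ_le_const[where X="\<lambda>n. (\<Sum>t<n. survive s' t) + B * survive s' n"]) auto
  then show ?thesis
    unfolding nn_integral_hitting_time survive_def[symmetric]
    by (subst suminf_ennreal2) (auto simp: True survive_nonneg intro: ennreal_leI)
qed

end

subsection \<open>The hard family\<close>

definition mix_pmf :: "real \<Rightarrow> 'x \<Rightarrow> 'x \<Rightarrow> 'x pmf" where
  "mix_pmf p u v = map_pmf (\<lambda>b. if b then u else v) (bernoulli_pmf p)"

lemma expectation_mix_pmf:
  fixes f :: "'x \<Rightarrow> real"
  assumes "0 \<le> p" "p \<le> 1"
  shows "measure_pmf.expectation (mix_pmf p u v) f = p * f u + (1 - p) * f v"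
  using assms by (simp add: mix_pmf_def)

lemma finite_mix_pmf: "finite (set_pmf (mix_pmf p u v))"
  by (simp add: mix_pmf_def)

lemma set_mix_pmf_subset: "set_pmf (mix_pmf p u v) \<subseteq> {u, v}"
  by (auto simp: mix_pmf_def)

text \<open>Number of increments modulo \<open>m\<close> from \<open>q\<close> to the target
  \<open>q'\<close>.\<close>

definition cyc_dist :: "nat \<Rightarrow> nat \<Rightarrow> nat \<Rightarrow> nat" where
  "cyc_dist m q' q = (if q \<le> q' then q' - q else q' + m - q)"

lemma cyc_dist_self [simp]: "cyc_dist m q q = 0"
  by (simp add: cyc_dist_def)

lemma cyc_dist_less: "q < m \<Longrightarrow> q' < m \<Longrightarrow> cyc_dist m q' q < m"
  by (auto simp: cyc_dist_def)

lemma cyc_dist_Suc: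
  assumes "q < m" "q' < m" "q \<noteq> q'"
  shows "cyc_dist m q' q = Suc (cyc_dist m q' (Suc q mod m))"
  using assms by (cases "Suc q = m") (auto simp: cyc_dist_def)

section \<open>Abstract trees\<close>

locale nav_nodes =
  fixes n A G :: nat and leaf :: "nat \<Rightarrow> bool"
begin

definition node :: "nat \<Rightarrow> bool" where "node x \<longleftrightarrow> x < n \<and> x \<noteq> G"

definition inner :: "nat \<Rightarrow> bool" where "inner x \<longleftrightarrow> node x \<and> \<not> leaf x"

end

text \<open>\<open>hgt\<close> is the distance to a nearest leaf, given by its one-step recursion,
  and \<open>anc\<close> the reflexive ancestor relation. Different actions may lead to the same
  child. The base locale exists because the axioms speak of \<open>node\<close> and
  \<open>inner\<close>.\<close>

locale nav_tree = nav_nodes +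
  fixes R :: nat and child :: "nat \<Rightarrow> nat \<Rightarrow> nat" and dep hgt :: "nat \<Rightarrow> nat"
    and anc :: "nat \<Rightarrow> nat \<Rightarrow> bool"
  assumes G: "G < n" and R: "node R" and A: "2 \<le> A"
    and child: "inner x \<Longrightarrow> a < A \<Longrightarrow> node (child x a)"
    and dep_R: "dep R = 0"
    and dep_child: "inner x \<Longrightarrow> a < A \<Longrightarrow> dep (child x a) = Suc (dep x)"
    and hgt_leaf: "node x \<Longrightarrow> leaf x \<Longrightarrow> hgt x = 0"
    and hgt_child: "inner x \<Longrightarrow> a < A \<Longrightarrow> hgt x \<le> Suc (hgt (child x a))"
    and hgt_child_ex: "inner x \<Longrightarrow> \<exists>a<A. hgt x = Suc (hgt (child x a))"
    and anc_refl: "node x \<Longrightarrow> anc x x"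
    and anc_R: "node x \<Longrightarrow> anc R x"
    and anc_leaf: "node x \<Longrightarrow> leaf x \<Longrightarrow> node y \<Longrightarrow> anc x y \<Longrightarrow> x = y"
    and anc_child_ex: "inner x \<Longrightarrow> node y \<Longrightarrow> anc x y \<Longrightarrow> x \<noteq> y \<Longrightarrow> \<exists>a<A. anc (child x a) y"
    and anc_child: "inner x \<Longrightarrow> a < A \<Longrightarrow> anc (child x a) y \<Longrightarrow> anc x y"
    and anc_dep: "node y \<Longrightarrow> anc x y \<Longrightarrow> dep x \<le> dep y"

context nav_tree
begin

lemma finite_nodes: "finite {x. node x}"
  by (rule finite_subset[of _ "{..<n}"]) (auto simp: node_def)

definition hmax :: nat where "hmax = Max (hgt ` {x. node x})"

definition dmax :: nat where "dmax = Max (dep ` {x. node x})"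

lemma hgt_le: "node x \<Longrightarrow> hgt x \<le> hmax"
  and dep_le: "node x \<Longrightarrow> dep x \<le> dmax"
  using finite_nodes by (auto simp: hmax_def dmax_def intro!: Max_ge)

lemma hmax_attained: "\<exists>x. node x \<and> hgt x = hmax"
  and dmax_attained: "\<exists>x. node x \<and> dep x = dmax"
proof -
  have ne: "{x. node x} \<noteq> {}" using R by auto
  show "\<exists>x. node x \<and> hgt x = hmax"
    using Max_in[of "hgt ` {x. node x}"] finite_nodes ne unfolding hmax_def by fastforce
  show "\<exists>x. node x \<and> dep x = dmax"
    using Max_in[of "dep ` {x. node x}"] finite_nodes ne unfolding dmax_def by fastforce
qed

end

locale hard_family = nav_tree +
  fixes Q E :: nat and \<gamma> \<delta> :: real
  assumes Q: "2 \<le> Q" and E: "4 \<le> E" and \<gamma>: "0 < \<gamma>" "\<gamma> \<le> 1" and \<delta>: "0 < \<delta>" "\<delta> < 1"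
begin

text \<open>Four labels occur, whence \<open>4 \<le> E\<close>: \<open>{1}\<close> advances the
  machine, \<open>{}\<close> leaves it in place, and \<open>{0}\<close> and \<open>{2}\<close> tell
  leaves from inner nodes for the payment.\<close>

definition lab :: "nat \<Rightarrow> nat \<Rightarrow> nat set" where
  "lab x a = (if x = G then if a = 0 then {1} else {} else if leaf x then {0} else {2})"

text \<open>Stationary probability of being away from \<open>G\<close> in the two-state chain that
  leaves \<open>G\<close> with probability \<gamma> and returns with probability \<delta>.\<close>

definition base_gain :: real where "base_gain = \<gamma> / (\<gamma> + \<delta>)"

definition bias :: real where "bias = 1 / (\<gamma> + \<delta>)"

definition pay :: "nat set \<Rightarrow> real" where
  "pay \<sigma> = (if \<sigma> = {0} then 1 else if \<sigma> = {2} then base_gain else 0)"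

definition rate :: "real \<Rightarrow> nat \<times> nat \<Rightarrow> nat \<Rightarrow> nat \<Rightarrow> real" where
  "rate \<epsilon> z x a = (if (x, a) = z then \<delta> - \<epsilon> else \<delta>)"

definition obs_tr :: "real \<Rightarrow> nat \<times> nat \<Rightarrow> nat \<Rightarrow> nat \<Rightarrow> nat pmf" where
  "obs_tr \<epsilon> z x a =
    (if x = G then if a = 0 then return_pmf G else mix_pmf \<gamma> R G
     else if leaf x then mix_pmf (rate \<epsilon> z x a) G x else return_pmf (child x a))"

definition rm_tr :: "nat \<Rightarrow> nat set \<Rightarrow> nat" where
  "rm_tr q \<sigma> = (if \<sigma> = {1} then Suc q mod Q else q)"

text \<open>Further singletons bring the set of relevant labels to size exactly
  \<open>E\<close>.\<close>

definition member :: "real \<Rightarrow> nat \<times> nat \<Rightarrow> (nat, nat, nat, nat) mdprm" where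
  "member \<epsilon> z =
     \<lparr>obs_set = {..<n}, act_set = {..<A}, obs_trans = obs_tr \<epsilon> z,
      machine = \<lparr>rm_states = {..<Q}, rm_trans = rm_tr, rm_output = (\<lambda>q \<sigma>. return borel (pay \<sigma>)),
        relevant_labels = (\<lambda>q. insert {} ((\<lambda>i. {i}) ` {..<E - 1}))\<rparr>,
      props = {..<E}, label = lab\<rparr>"

definition arms :: "(nat \<times> nat) set" where
  "arms = {x. node x \<and> leaf x} \<times> {..<A}"

definition perturbation :: "real \<Rightarrow> bool" where
  "perturbation \<epsilon> \<longleftrightarrow> 0 \<le> \<epsilon> \<and> \<epsilon> < \<delta>"

abbreviation "cross \<epsilon> z \<equiv> cross_product (member \<epsilon> z)"
abbreviation "states \<equiv> {..<Q} \<times> {..<n}"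

lemma member_simps [simp]:
  "obs_set (member \<epsilon> z) = {..<n}" "act_set (member \<epsilon> z) = {..<A}"
  "rm_states (machine (member \<epsilon> z)) = {..<Q}" "label (member \<epsilon> z) = lab"
  "mdp_states (cross \<epsilon> z) = states" "mdp_actions (cross \<epsilon> z) = {..<A}"
  by (simp_all add: member_def cross_product_def)

lemma node_cases:
  assumes "x < n"
  obtains "x = G" | "node x" "leaf x" "x \<noteq> G" | "inner x" "node x" "\<not> leaf x" "x \<noteq> G"
  using assms by (auto simp: node_def inner_def)

text \<open>The last two equations are the Poisson equations for \<epsilon> = 0: the expected change
  of the potential balances the missing gain at \<open>G\<close> and the surplus at a leaf.\<close>

lemma base_gain: "0 < base_gain" "base_gain < 1" "base_gain = \<gamma> * bias" "1 - base_gain = \<delta> * bias"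
  using \<gamma> \<delta> by (auto simp: base_gain_def bias_def field_simps)

lemma bias_pos: "0 < bias"
  using \<gamma> \<delta> by (simp add: bias_def)

lemma is_mdprm_member: "is_mdprm (member \<epsilon> z)"
proof -
  have "set_pmf (obs_tr \<epsilon> z x a) \<subseteq> {..<n}" if x: "x < n" and a: "a < A" for x a
    using x
  proof (cases rule: node_cases)
    case 1
    then show ?thesis using set_mix_pmf_subset[of \<gamma> R G] G R by (auto simp: obs_tr_def node_def)
  next
    case 2
    then show ?thesis using set_mix_pmf_subset[of "rate \<epsilon> z x a" G x] x G by (auto simp: obs_tr_def)
  next
    case 3
    then show ?thesis using child[OF _ a] by (auto simp: obs_tr_def node_def)
  qed
  moreover have "0 < n" using G by simp
  moreover have "0 \<le> pay \<sigma> \<and> pay \<sigma> \<le> 1" for \<sigma> using base_gain by (simp add: pay_def)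
  then have "AE r in return borel (pay \<sigma>). r \<in> {0..1}" for \<sigma> by (subst AE_return) auto
  moreover have ro: "rm_output (machine (member \<epsilon> z)) = (\<lambda>q \<sigma>. return borel (pay \<sigma>))"
    by (simp add: member_def)
  ultimately show ?thesis
    using A Q E unfolding is_mdprm_def is_reward_machine_def ro
    by (auto simp: member_def lab_def rm_tr_def prob_space_return lessThan_empty_iff
        simp del: atLeastAtMost_iff AE_conj_iff)
qed

lemma max_relevant_member: "max_relevant (member \<epsilon> z) = E"
proof -
  have "card (insert {} ((\<lambda>i. {i}) ` {..<E - 1}) :: nat set set) = E"
    using E by (subst card_insert_disjoint) (auto simp: card_image inj_on_def)
  moreover have "{..<Q} \<noteq> {}" using Q by (auto simp: lessThan_empty_iff)
  ultimately show ?thesis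
    by (simp add: max_relevant_def member_def image_constant_conv)
qed

definition reward :: "nat \<times> nat \<Rightarrow> nat \<Rightarrow> real" where
  "reward s a = pay (lab (snd s) a)"

lemma reward_cross: "mdp_reward (cross \<epsilon> z) s a = return borel (reward s a)"
  by (simp add: cross_product_def member_def reward_def case_prod_beta)

lemma trans_cross: "mdp_trans (cross \<epsilon> z) (q, x) a = map_pmf (Pair (rm_tr q (lab x a))) (obs_tr \<epsilon> z x a)"
  by (simp add: cross_product_def member_def)

lemma finite_trans_cross: "finite (set_pmf (mdp_trans (cross \<epsilon> z) s a))"
  by (cases s) (simp add: trans_cross obs_tr_def finite_mix_pmf)

lemma set_trans_cross:
  assumes "s \<in> states" "a < A"
  shows "set_pmf (mdp_trans (cross \<epsilon> z) s a) \<subseteq> states"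
proof -
  have "\<forall>x\<in>{..<n}. \<forall>a\<in>{..<A}. set_pmf (obs_tr \<epsilon> z x a) \<subseteq> {..<n}"
    using is_mdprm_member[of \<epsilon> z] unfolding is_mdprm_def by (simp add: member_def)
  then show ?thesis
    using assms Q by (cases s) (force simp: trans_cross rm_tr_def)
qed

lemma rate_bounds:
  assumes "perturbation \<epsilon>"
  shows "0 < rate \<epsilon> z x a" "rate \<epsilon> z x a \<le> \<delta>" "rate \<epsilon> z x a \<le> 1"
  using assms \<delta> by (auto simp: rate_def perturbation_def)

lemma expectation_trans_cross:
  fixes V :: "nat \<times> nat \<Rightarrow> real"
  assumes "perturbation \<epsilon>"
  shows
    "measure_pmf.expectation (mdp_trans (cross \<epsilon> z) (q, G) 0) V = V (Suc q mod Q, G)"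
    "a \<noteq> 0 \<Longrightarrow> measure_pmf.expectation (mdp_trans (cross \<epsilon> z) (q, G) a) V =
      \<gamma> * V (q, R) + (1 - \<gamma>) * V (q, G)"
    "node x \<Longrightarrow> leaf x \<Longrightarrow> measure_pmf.expectation (mdp_trans (cross \<epsilon> z) (q, x) a) V =
      rate \<epsilon> z x a * V (q, G) + (1 - rate \<epsilon> z x a) * V (q, x)"
    "inner x \<Longrightarrow> measure_pmf.expectation (mdp_trans (cross \<epsilon> z) (q, x) a) V = V (q, child x a)"
  using \<gamma> less_imp_le[OF rate_bounds(1)[OF assms]] rate_bounds(3)[OF assms]
  by (auto simp: trans_cross obs_tr_def lab_def rm_tr_def expectation_mix_pmf node_def inner_def)

lemma reward_simps:
  "reward (q, G) 0 = 0" "a \<noteq> 0 \<Longrightarrow> reward (q, G) a = 0"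
  "node x \<Longrightarrow> leaf x \<Longrightarrow> reward (q, x) a = 1" "inner x \<Longrightarrow> reward (q, x) a = base_gain"
  by (auto simp: reward_def pay_def lab_def node_def inner_def)

lemma reward_range: "0 \<le> reward s a" "reward s a \<le> 1"
  using base_gain by (simp_all add: reward_def pay_def)

lemma decision_rule_stationary:
  "range \<pi> \<subseteq> B \<Longrightarrow> decision_rule step_space B (stationary \<pi>)"
  by (auto simp: decision_rule_def stationary_def)

text \<open>The diameter ranges over extensional policies, whose value off the states is a default
  outside the control of \<open>A\<close>; the constant \<open>c\<close> absorbs it.\<close>

lemma confined_stationary:
  assumes "\<And>s. s \<in> states \<Longrightarrow> \<pi> s < A" "\<And>s. s \<notin> states \<Longrightarrow> \<pi> s = c" "s\<^sub>1 \<in> states"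
  shows "confined_mdp (cross \<epsilon> z) reward (insert c {..<A}) (stationary \<pi>) s\<^sub>1 states (\<lambda>s. {\<pi> s})"
proof unfold_locales
  show "decision_rule step_space (insert c {..<A}) (stationary \<pi>)"
    using assms by (intro decision_rule_stationary) (metis image_subsetI insert_iff lessThan_iff)
qed (use assms in \<open>auto simp: reward_cross finite_trans_cross stationary_def dest!: subsetD[OF set_trans_cross, rotated -1]\<close>)

subsection \<open>The diameter\<close>

definition leaf_step :: "nat \<Rightarrow> nat" where
  "leaf_step x = (SOME a. a < A \<and> hgt x = Suc (hgt (child x a)))"

definition path_step :: "nat \<Rightarrow> nat \<Rightarrow> nat" where
  "path_step y x = (SOME a. a < A \<and> anc (child x a) y)"

lemma leaf_step: "inner x \<Longrightarrow> leaf_step x < A \<and> hgt x = Suc (hgt (child x (leaf_step x)))"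
  unfolding leaf_step_def using hgt_child_ex[of x] by (rule someI_ex)

lemma path_step: "inner x \<Longrightarrow> node y \<Longrightarrow> anc x y \<Longrightarrow> x \<noteq> y \<Longrightarrow> path_step y x < A \<and> anc (child x (path_step y x)) y"
  unfolding path_step_def using anc_child_ex[of x y] by (rule someI_ex)

definition plain_arm :: "nat \<times> nat \<Rightarrow> nat \<Rightarrow> nat" where
  "plain_arm z x = (if z = (x, 0) then 1 else 0)"

lemma plain_arm: "plain_arm z x < A" "rate \<epsilon> z x (plain_arm z x) = \<delta>"
  using A by (auto simp: plain_arm_def rate_def)

text \<open>The longest itinerary: down to a nearest leaf, wait for the fall, step through the
  machine, wait to leave \<open>G\<close>, descend to a deepest node.\<close>

definition diam :: real where
  "diam = real hmax + 1 / \<delta> + real (Q - 1) + 1 / \<gamma> + real dmax"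

text \<open>Least expected time to reach \<open>(q', y)\<close>. Direct descent is possible only
  from an ancestor of \<open>y\<close> with the machine already in \<open>q'\<close>; from elsewhere
  in the tree the way leads through a leaf and \<open>G\<close>.\<close>

definition V_node :: "nat \<Rightarrow> nat \<Rightarrow> nat \<times> nat \<Rightarrow> real" where
  "V_node q' y = (\<lambda>(q, x).
     if x = G then real (cyc_dist Q q' q) + 1 / \<gamma> + real (dep y)
     else if q = q' \<and> anc x y then real (dep y) - real (dep x)
     else real (hgt x) + 1 / \<delta> + real (cyc_dist Q q' q) + 1 / \<gamma> + real (dep y))"

definition V_G :: "nat \<Rightarrow> nat \<times> nat \<Rightarrow> real" where
  "V_G q' = (\<lambda>(q, x). if x = G then real (cyc_dist Q q' q)
     else real (hgt x) + 1 / \<delta> + real (cyc_dist Q q' q))"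

lemma V_node_bounds:
  assumes "q < Q" "q' < Q" "x < n" "node y"
  shows "0 \<le> V_node q' y (q, x)" "V_node q' y (q, x) \<le> diam"
proof -
  have W: "cyc_dist Q q' q \<le> Q - 1" using cyc_dist_less[of q Q q'] assms by simp
  define i j where "i = 1 / \<gamma>" and "j = 1 / \<delta>"
  have ij: "0 < i" "0 < j" using \<gamma> \<delta> by (simp_all add: i_def j_def)
  show "0 \<le> V_node q' y (q, x)"
    using assms ij anc_dep[of y x] by (auto simp: V_node_def node_def i_def[symmetric] j_def[symmetric])
  show "V_node q' y (q, x) \<le> diam"
    using W ij hgt_le[of x] dep_le[of y] assms
    by (auto simp: V_node_def node_def diam_def i_def[symmetric] j_def[symmetric])
qed

lemma V_G_bounds:
  assumes "q < Q" "q' < Q" "x < n"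
  shows "0 \<le> V_G q' (q, x)" "V_G q' (q, x) \<le> diam"
proof -
  have W: "cyc_dist Q q' q \<le> Q - 1" using cyc_dist_less[of q Q q'] assms by simp
  define i j where "i = 1 / \<gamma>" and "j = 1 / \<delta>"
  have ij: "0 < i" "0 < j" using \<gamma> \<delta> by (simp_all add: i_def j_def)
  then show "0 \<le> V_G q' (q, x)" by (simp add: V_G_def j_def[symmetric])
  show "V_G q' (q, x) \<le> diam"
    using W ij hgt_le[of x] assms
    by (auto simp: V_G_def node_def diam_def i_def[symmetric] j_def[symmetric])
qed

text \<open>The policy that follows the itinerary encoded in the potential has drift at most -1
  everywhere, and the potential never exceeds \<open>diam\<close>.\<close>

lemma hitting_time_le_diam:
  assumes p: "perturbation \<epsilon>" and s: "s \<in> states" and s': "s' \<in> states"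
  shows "\<exists>\<pi>\<in>states \<rightarrow>\<^sub>E {..<A}.
    (\<integral>\<^sup>+ \<omega>. hitting_time s' \<omega> \<partial>trajectory (cross \<epsilon> z) (stationary \<pi>) s) \<le> ennreal diam"
proof -
  obtain q' y where s'_eq: "s' = (q', y)" and q': "q' < Q" and y: "y < n" using s' by auto
  note step = expectation_trans_cross[OF p]
  show ?thesis
  proof (cases "y = G")
    case True
    define \<pi> where "\<pi> = (\<lambda>(q, x)\<in>states. if x = G then (if q = q' then 1 else 0)
      else if leaf x then plain_arm z x else leaf_step x)"
    have \<pi>: "\<pi> s < A" if "s \<in> states" for s
      using that A plain_arm(1)[of z] leaf_step by (auto simp: \<pi>_def inner_def node_def)
    interpret confined_mdp "cross \<epsilon> z" reward "insert undefined {..<A}" "stationary \<pi>" s states "\<lambda>s. {\<pi> s}"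
      by (rule confined_stationary[OF \<pi> _ s]) (auto simp: \<pi>_def)
    have "(\<integral>\<^sup>+ \<omega>. hitting_time s' \<omega> \<partial>traj) \<le> ennreal (V_G q' s)"
    proof (rule hitting_time_le)
      show "V_G q' s' = 0" by (simp add: s'_eq True V_G_def)
      show "0 \<le> V_G q' s" if "s \<in> states" for s using that V_G_bounds(1)[OF _ q'] by auto
      fix s a assume s: "s \<in> states" and a: "a \<in> {\<pi> s}" and ne: "s \<noteq> s'"
      obtain q x where s_eq: "s = (q, x)" and q: "q < Q" and x: "x < n" using s by auto
      from x show "1 + measure_pmf.expectation (mdp_trans (cross \<epsilon> z) s a) (V_G q') \<le> V_G q' s"
      proof (cases rule: node_cases)
        case 1
        then have "q \<noteq> q'" using ne by (simp add: s_eq s'_eq True)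
        then show ?thesis using 1 a q x cyc_dist_Suc[OF q q'] by (simp add: s_eq \<pi>_def step V_G_def)
      next
        case 2
        then show ?thesis using a q x \<delta>
          by (simp add: s_eq \<pi>_def step plain_arm V_G_def hgt_leaf field_simps)
      next
        case 3
        with leaf_step[of x] child[of x "leaf_step x"] show ?thesis using a q x
          by (simp add: s_eq \<pi>_def step V_G_def node_def)
      qed
    qed
    also have "\<dots> \<le> ennreal diam"
      using s V_G_bounds(2)[OF _ q'] by (intro ennreal_leI) auto
    finally show ?thesis using \<pi> by (intro bexI[of _ \<pi>]) (auto simp: \<pi>_def)
  next
    case False
    then have y: "node y" using y by (simp add: node_def)
    define \<pi> where "\<pi> = (\<lambda>(q, x)\<in>states. if x = G then (if q = q' then 1 else 0)
      else if leaf x then plain_arm z x else if q = q' \<and> anc x y \<and> x \<noteq> y then path_step y x else leaf_step x)"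
    have \<pi>: "\<pi> s < A" if "s \<in> states" for s
      using that A y plain_arm(1)[of z] leaf_step path_step by (auto simp: \<pi>_def inner_def node_def)
    interpret confined_mdp "cross \<epsilon> z" reward "insert undefined {..<A}" "stationary \<pi>" s states "\<lambda>s. {\<pi> s}"
      by (rule confined_stationary[OF \<pi> _ s]) (auto simp: \<pi>_def)
    have "(\<integral>\<^sup>+ \<omega>. hitting_time s' \<omega> \<partial>traj) \<le> ennreal (V_node q' y s)"
    proof (rule hitting_time_le)
      show "V_node q' y s' = 0" using y anc_refl[OF y] by (simp add: s'_eq V_node_def node_def)
      show "0 \<le> V_node q' y s" if "s \<in> states" for s using that V_node_bounds(1)[OF _ q' _ y] by auto
      fix s a assume s: "s \<in> states" and a: "a \<in> {\<pi> s}" and ne: "s \<noteq> s'"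
      obtain q x where s_eq: "s = (q, x)" and q: "q < Q" and x: "x < n" using s by auto
      from x show "1 + measure_pmf.expectation (mdp_trans (cross \<epsilon> z) s a) (V_node q' y) \<le> V_node q' y s"
      proof (cases rule: node_cases)
        case 1
        then show ?thesis using a q x cyc_dist_Suc[OF q q'] R anc_R[OF y] dep_R \<gamma>
          by (cases "q = q'") (simp_all add: s_eq \<pi>_def step V_node_def node_def field_simps)
      next
        case 2
        then have "\<not> (q = q' \<and> anc x y)" using ne y anc_leaf[of x y] by (auto simp: s_eq s'_eq)
        with 2 show ?thesis using a q x \<delta>
          by (auto simp: s_eq \<pi>_def step plain_arm V_node_def hgt_leaf field_simps)
      next
        case 3
        show ?thesis
        proof (cases "q = q' \<and> anc x y")
          case True
          then have "x \<noteq> y" using ne by (auto simp: s_eq s'_eq)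
          with True y 3 path_step[of x y] child[of x "path_step y x"] dep_child[of x "path_step y x"]
          show ?thesis using a q x
            by (simp add: s_eq \<pi>_def step V_node_def node_def)
        next
          case False
          \<comment> \<open>Children of a non-ancestor of \<open>y\<close> are non-ancestors, so the
            descent to a leaf stays in the last branch of the potential.\<close>
          with 3 leaf_step[of x] child[of x "leaf_step x"] anc_child[of x "leaf_step x" y]
          show ?thesis using a q x
            by (auto simp: s_eq \<pi>_def step V_node_def node_def)
        qed
      qed
    qed
    also have "\<dots> \<le> ennreal diam"
      using s V_node_bounds(2)[OF _ q' _ y] by (intro ennreal_leI) auto
    finally show ?thesis using \<pi> by (intro bexI[of _ \<pi>]) (auto simp: \<pi>_def)
  qed
qed

text \<open>From a node farthest from the leaves in machine state 0 to a deepest node in state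
  \<open>Q - 1\<close>: the machine states differ, so no shortcut applies and the potential equals
  \<open>diam\<close>. Its drift is at least -1 under every action, hence under every
  policy.\<close>

lemma diam_le_hitting_time:
  assumes p: "perturbation \<epsilon>"
  obtains s s' where "s \<in> states" "s' \<in> states" "s \<noteq> s'"
    "\<And>\<pi>. \<pi> \<in> states \<rightarrow>\<^sub>E {..<A} \<Longrightarrow>
      ennreal diam \<le> (\<integral>\<^sup>+ \<omega>. hitting_time s' \<omega> \<partial>trajectory (cross \<epsilon> z) (stationary \<pi>) s)"
proof -
  note step = expectation_trans_cross[OF p]
  obtain x\<^sub>0 y where x\<^sub>0: "node x\<^sub>0" "hgt x\<^sub>0 = hmax" and y: "node y" "dep y = dmax"
    using hmax_attained dmax_attained by blast
  define q' where "q' = Q - 1"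
  have q': "q' < Q" "0 \<noteq> q'" using Q by (auto simp: q'_def)
  let ?s = "(0 :: nat, x\<^sub>0)" and ?s' = "(q', y)"
  show ?thesis
  proof (rule that[of ?s ?s'])
    show s: "?s \<in> states" using Q x\<^sub>0 by (auto simp: node_def)
    show "?s' \<in> states" "?s \<noteq> ?s'" using q' y by (auto simp: node_def)
    fix \<pi> assume \<pi>: "\<pi> \<in> states \<rightarrow>\<^sub>E {..<A}"
    interpret confined_mdp "cross \<epsilon> z" reward "insert undefined {..<A}" "stationary \<pi>" ?s states "\<lambda>s. {\<pi> s}"
      by (rule confined_stationary) (use \<pi> s in \<open>auto simp: PiE_def extensional_def Pi_def\<close>)
    have "V_node q' y ?s = diam"
      using x\<^sub>0 y q' by (simp add: V_node_def diam_def node_def) (simp add: cyc_dist_def q'_def)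
    moreover have "ennreal (V_node q' y ?s) \<le> (\<integral>\<^sup>+ \<omega>. hitting_time ?s' \<omega> \<partial>traj)"
    proof (rule hitting_time_ge)
      show "V_node q' y ?s' = 0" using y anc_refl[OF y(1)] by (simp add: V_node_def node_def)
      show "V_node q' y s \<le> diam" if "s \<in> states" for s
        using that V_node_bounds(2)[OF _ q'(1) _ y(1)] by auto
      fix s a assume s: "s \<in> states" and a': "a \<in> {\<pi> s}" and ne: "s \<noteq> ?s'"
      have a: "a < A" using a' \<pi> s by auto
      obtain q x where s_eq: "s = (q, x)" and q: "q < Q" and x: "x < n" using s by auto
      from x show "V_node q' y s \<le> 1 + measure_pmf.expectation (mdp_trans (cross \<epsilon> z) s a) (V_node q' y)"
      proof (cases rule: node_cases)
        case 1
        show ?thesis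
        proof (cases "a = 0")
          case True
          then show ?thesis using 1 cyc_dist_Suc[OF q q'(1)]
            by (cases "q = q'") (simp_all add: s_eq step V_node_def)
        next
          case False
          \<comment> \<open>Leaving \<open>G\<close> gains \<open>1 / \<gamma>\<close> in the right
            machine state; in any other it is a detour.\<close>
          have "\<gamma> * (V_node q' y (q, G) - V_node q' y (q, R)) \<le> 1"
          proof (cases "q = q'")
            case True
            then show ?thesis using \<gamma> R anc_R[OF y(1)] dep_R by (simp add: V_node_def node_def)
          next
            case False
            then have "V_node q' y (q, G) \<le> V_node q' y (q, R)"
              using \<delta> R by (simp add: V_node_def node_def)
            then show ?thesis using \<gamma> by (smt (verit) mult_nonneg_nonpos)
          qed
          then show ?thesis using False 1 by (simp add: s_eq step algebra_simps)
        qed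
      next
        case 2
        then have "\<not> (q = q' \<and> anc x y)" using ne y anc_leaf[of x y] by (auto simp: s_eq)
        with 2 have "V_node q' y (q, x) - V_node q' y (q, G) = 1 / \<delta>"
          by (auto simp: V_node_def hgt_leaf)
        \<comment> \<open>No action leaves a leaf with probability above \<delta>, so the hidden
          pair cannot shorten any way.\<close>
        then have "rate \<epsilon> z x a * (V_node q' y (q, x) - V_node q' y (q, G)) \<le> 1"
          using rate_bounds(2)[OF p, of z x a] \<delta> by simp
        then show ?thesis using 2 by (simp add: s_eq step algebra_simps)
      next
        case 3
        note c = child[OF 3(1) a] dep_child[OF 3(1) a] hgt_child[OF 3(1) a] anc_child[OF 3(1) a, of y]
        define i j where "i = 1 / \<gamma>" and "j = 1 / \<delta>"
        have pos: "0 < i" "0 < j" using \<gamma> \<delta> by (simp_all add: i_def j_def)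
        have "V_node q' y (q, x) \<le> 1 + V_node q' y (q, child x a)"
        proof (cases "q = q' \<and> anc x y")
          case True
          then show ?thesis using 3 c pos
            by (auto simp: V_node_def node_def i_def[symmetric] j_def[symmetric])
        next
          case False
          then have "\<not> (q = q' \<and> anc (child x a) y)" using c by auto
          with False show ?thesis using 3 c by (auto simp: V_node_def node_def)
        qed
        then show ?thesis using 3 by (simp add: s_eq step)
      qed
    qed
    ultimately show "ennreal diam \<le> (\<integral>\<^sup>+ \<omega>. hitting_time ?s' \<omega> \<partial>traj)" by simp
  qed
qed

lemma diameter_cross:
  assumes p: "perturbation \<epsilon>"
  shows "diameter_mdp (cross \<epsilon> z) = ennreal diam"
proof (rule antisym)
  show "diameter_mdp (cross \<epsilon> z) \<le> ennreal diam"
  proof -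
    have "(INF \<pi>\<in>states \<rightarrow>\<^sub>E {..<A}.
        \<integral>\<^sup>+ \<omega>. hitting_time s' \<omega> \<partial>trajectory (cross \<epsilon> z) (stationary \<pi>) s) \<le> ennreal diam"
      if "s \<in> states" "s' \<in> states" for s s'
      using hitting_time_le_diam[OF p that, of z] by (auto intro: INF_lower2)
    then show ?thesis
      unfolding diameter_mdp_def member_simps by (intro SUP_least) auto
  qed
  obtain s s' where s: "s \<in> states" "s' \<in> states" "s \<noteq> s'"
    "\<And>\<pi>. \<pi> \<in> states \<rightarrow>\<^sub>E {..<A} \<Longrightarrow>
      ennreal diam \<le> (\<integral>\<^sup>+ \<omega>. hitting_time s' \<omega> \<partial>trajectory (cross \<epsilon> z) (stationary \<pi>) s)"
    using diam_le_hitting_time[OF p, of z] by blast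
  show "ennreal diam \<le> diameter_mdp (cross \<epsilon> z)"
    unfolding diameter_mdp_def using s
    by (intro SUP_upper2[of "(s, s')"]) (auto intro!: INF_greatest)
qed

end

section \<open>Point masses of pairs and of two-point mixtures\<close>

lemma pmf_bind_map_Pair:
  "pmf (bind_pmf p (\<lambda>s. map_pmf (Pair s) (r s))) (s, a) = pmf p s * pmf (r s) a"
proof -
  have "pmf (map_pmf (Pair s') (r s')) (s, a) = indicator {s} s' * pmf (r s) a" for s'
  proof (cases "s' = s")
    case True
    then show ?thesis using pmf_map_inj'[of "Pair s" "r s" a] by (simp add: inj_def)
  next
    case False
    then have "(s, a) \<notin> set_pmf (map_pmf (Pair s') (r s'))" by auto
    then show ?thesis using False by (simp add: pmf_eq_0_set_pmf)
  qed
  then show ?thesis by (simp add: pmf_bind measure_pmf_single)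
qed

lemma pmf_mix_pmf:
  assumes "u \<noteq> v" "0 \<le> p" "p \<le> 1"
  shows "pmf (mix_pmf p u v) u = p" "pmf (mix_pmf p u v) v = 1 - p"
  using pmf_map_inj'[of "\<lambda>b. if b then u else v" "bernoulli_pmf p" True]
    pmf_map_inj'[of "\<lambda>b. if b then u else v" "bernoulli_pmf p" False] assms
  by (auto simp: mix_pmf_def inj_def)

context hard_family
begin

subsection \<open>Gain and regret\<close>

lemma confined_rule:
  assumes "decision_rule step_space {..<A} \<pi>" "s\<^sub>1 \<in> states"
  shows "confined_mdp (cross \<epsilon> z) reward {..<A} \<pi> s\<^sub>1 states (\<lambda>_. {..<A})"
proof unfold_locales
  show "set_pmf (\<pi> t h s) \<subseteq> {..<A}" for t h s
    using assms(1) unfolding decision_rule_def by blast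
  show "set_pmf (mdp_trans (cross \<epsilon> z) s a) \<subseteq> states" if "s \<in> states" "a \<in> {..<A}" for s a
    using set_trans_cross[OF that(1)] that(2) by simp
qed (use assms in \<open>auto simp: reward_cross finite_trans_cross\<close>)

text \<open>Caps the supremum in \<open>optimal_gain\<close> at 1, so that its conversion to a real
  number is faithful.\<close>

lemma total_reward_le:
  assumes "decision_rule step_space {..<A} \<pi>" "s\<^sub>1 \<in> states"
  shows "(\<integral>\<omega>. total_reward T \<omega> \<partial>trajectory (cross \<epsilon> z) \<pi> s\<^sub>1) \<le> real T"
proof -
  interpret confined_mdp "cross \<epsilon> z" reward "{..<A}" \<pi> s\<^sub>1 states "\<lambda>_. {..<A}"
    by (rule confined_rule[OF assms])
  have "(\<Sum>(s, a)\<leftarrow>l. reward s a) \<le> real (length l)" for l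
  proof (induction l)
    case (Cons w l)
    then show ?case using reward_range(2)[of "fst w" "snd w"] by (simp add: case_prod_beta)
  qed simp
  then have "measure_pmf.expectation (H T) (\<lambda>l. \<Sum>(s, a)\<leftarrow>l. reward s a) \<le>
      measure_pmf.expectation (H T) (\<lambda>l. real T)"
    by (intro expectation_finite_mono finite_H) (metis length_hist_pmf)
  then show ?thesis by (simp add: expectation_total_reward)
qed

text \<open>Expected length of a round trip from \<open>G\<close> to the leaf \<open>x\<close> and
  back when the hidden action is played there.\<close>

definition cycle :: "real \<Rightarrow> nat \<Rightarrow> real" where
  "cycle \<epsilon> x = 1 / \<gamma> + real (dep x) + 1 / (\<delta> - \<epsilon>)"

text \<open>Always travelling to \<open>x\<^sub>0\<close> and playing \<open>a\<^sub>0\<close> uses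
  the hidden pair in a fraction
  \<open>1 / ((\<delta> - \<epsilon>) * cycle \<epsilon> x\<^sub>0)\<close> of all rounds, and each
  use is worth \<open>\<epsilon> * bias\<close>.\<close>

lemma optimal_gain_ge:
  assumes p: "perturbation \<epsilon>" and z: "(x\<^sub>0, a\<^sub>0) \<in> arms" and q\<^sub>1: "q\<^sub>1 < Q"
  shows "base_gain + \<epsilon> * bias / ((\<delta> - \<epsilon>) * cycle \<epsilon> x\<^sub>0) \<le>
    optimal_gain (cross \<epsilon> (x\<^sub>0, a\<^sub>0)) (q\<^sub>1, G)"
proof -
  let ?z = "(x\<^sub>0, a\<^sub>0)"
  let ?N = "cross \<epsilon> ?z"
  let ?s = "(q\<^sub>1, G)"
  define \<rho> where "\<rho> = \<delta> - \<epsilon>"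
  define C where "C = cycle \<epsilon> x\<^sub>0"
  define g where "g = base_gain + \<epsilon> * bias / (\<rho> * C)"
  have x\<^sub>0: "node x\<^sub>0" "leaf x\<^sub>0" and a\<^sub>0: "a\<^sub>0 < A" using z by (auto simp: arms_def)
  have \<rho>: "0 < \<rho>" and \<epsilon>: "0 \<le> \<epsilon>" using p by (auto simp: \<rho>_def perturbation_def)
  have C: "C = 1 / \<gamma> + real (dep x\<^sub>0) + 1 / \<rho>" by (simp add: C_def cycle_def \<rho>_def)
  have C_pos: "0 < C" using \<gamma> \<rho> by (simp add: C add_pos_pos add_nonneg_pos)
  \<comment> \<open>Renewal reward: a cycle earns \<open>1 / \<rho>\<close> at the leaf and
    \<open>base_gain\<close> at each of the \<open>dep x\<^sub>0\<close> inner nodes on the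
    way.\<close>
  have gC: "g * C = 1 / \<rho> + real (dep x\<^sub>0) * base_gain"
  proof -
    have "g * C = base_gain * C + \<epsilon> * bias / \<rho>"
      using C_pos by (simp add: g_def distrib_right)
    also have "base_gain * C = bias + real (dep x\<^sub>0) * base_gain + base_gain / \<rho>"
      using \<gamma> base_gain(3) by (simp add: C algebra_simps)
    finally have "g * C = bias + real (dep x\<^sub>0) * base_gain + base_gain / \<rho> + \<epsilon> * bias / \<rho>" by simp
    moreover have "\<rho> * bias = 1 - base_gain - \<epsilon> * bias"
      using base_gain(4) by (simp add: \<rho>_def algebra_simps)
    then have "bias = (1 - base_gain - \<epsilon> * bias) / \<rho>" using \<rho> by (simp add: field_simps)
    then have "bias = 1 / \<rho> - base_gain / \<rho> - \<epsilon> * bias / \<rho>" by (simp only: diff_divide_distrib)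
    ultimately show ?thesis by linarith
  qed
  have g_ge: "base_gain \<le> g" using \<epsilon> \<rho> C_pos bias_pos by (simp add: g_def)
  have g_le: "g \<le> 1"
  proof -
    have "g * C \<le> 1 * C" unfolding gC
      using base_gain(2) \<gamma> by (simp add: C mult_left_le add_increasing)
    then show ?thesis using C_pos by simp
  qed
  \<comment> \<open>Value 0 off the states: \<open>optimal_gain\<close> admits only rules whose
    actions lie below \<open>A\<close> everywhere.\<close>
  define \<pi> where "\<pi> = (\<lambda>(q, x). if q < Q \<and> x < n then
    (if x = G then 1 else if leaf x then (if x = x\<^sub>0 then a\<^sub>0 else 0)
     else if anc x x\<^sub>0 then path_step x\<^sub>0 x else leaf_step x) else 0)"
  have \<pi>: "\<pi> s < A" for s
  proof -
    obtain q x where s: "s = (q, x)" by fastforce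
    show ?thesis
    proof (cases "q < Q \<and> x < n")
      case True
      then have "x < n" by simp
      then show ?thesis
      proof (cases rule: node_cases)
        case 3
        then show ?thesis using leaf_step[of x] path_step[of x x\<^sub>0] x\<^sub>0 by (auto simp: s \<pi>_def)
      qed (use A a\<^sub>0 True in \<open>auto simp: s \<pi>_def\<close>)
    qed (use A in \<open>auto simp: s \<pi>_def\<close>)
  qed
  \<comment> \<open>Relative value, signed as a cost. It is exact on the cycle through
    \<open>x\<^sub>0\<close>; elsewhere the number of steps to a leaf suffices, as a step costs at
    most 1.\<close>
  define k where "k = (\<lambda>(q :: nat, x). if x = G then 0
    else if anc x x\<^sub>0 then (real (dep x\<^sub>0) - real (dep x)) * (g - base_gain) - (1 - g) / \<rho>
    else real (hgt x))"
  have stat: "decision_rule step_space {..<A} (stationary \<pi>)"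
    using \<pi> by (intro decision_rule_stationary) auto
  have s: "?s \<in> states" using q\<^sub>1 G by simp
  have "confined_mdp ?N reward (insert 0 {..<A}) (stationary \<pi>) ?s states (\<lambda>s. {\<pi> s})"
    by (rule confined_stationary) (use s \<pi> in \<open>auto simp: \<pi>_def split: if_splits\<close>)
  then interpret confined_mdp ?N reward "insert 0 {..<A}" "stationary \<pi>" ?s states "\<lambda>s. {\<pi> s}" .
  let ?f = "\<lambda>w. g - reward (fst w) (snd w)"
  have k_step: "?f (s, a) + measure_pmf.expectation (mdp_trans ?N s a) k \<le> k s"
    if s: "s \<in> states" and a: "a \<in> {\<pi> s}" for s a
  proof -
    obtain q x where s_eq: "s = (q, x)" and q: "q < Q" and x: "x < n" using s by auto
    note step = expectation_trans_cross[OF p] reward_simps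
    from x show ?thesis
    proof (cases rule: node_cases)
      case 1
      have "\<gamma> * ((1 - g) / \<rho> - real (dep x\<^sub>0) * (g - base_gain)) = g"
      proof -
        have "(1 - g) / \<rho> - real (dep x\<^sub>0) * (g - base_gain) = g / \<gamma>"
          using gC by (simp add: C algebra_simps diff_divide_distrib)
        then show ?thesis using \<gamma> by simp
      qed
      then show ?thesis using 1 a q x R anc_R[OF x\<^sub>0(1)] dep_R
        by (simp add: s_eq \<pi>_def step k_def node_def algebra_simps)
    next
      case 2
      show ?thesis
      proof (cases "x = x\<^sub>0")
        case True
        then show ?thesis using 2 a q x \<rho> anc_refl[OF x\<^sub>0(1)]
          by (simp add: s_eq \<pi>_def step k_def rate_def \<rho>_def[symmetric] field_simps)
      next
        case False
        then have "\<not> anc x x\<^sub>0" using anc_leaf[of x x\<^sub>0] x\<^sub>0 2 by auto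
        then show ?thesis using 2 a q x g_le hgt_leaf
          by (simp add: s_eq \<pi>_def step k_def)
      qed
    next
      case 3
      show ?thesis
      proof (cases "anc x x\<^sub>0")
        case True
        moreover have "x \<noteq> x\<^sub>0" using 3 x\<^sub>0 by auto
        ultimately show ?thesis
          using 3 a q x path_step[of x x\<^sub>0] child[of x "path_step x\<^sub>0 x"] dep_child[of x "path_step x\<^sub>0 x"] x\<^sub>0
          by (auto simp: s_eq \<pi>_def step k_def node_def algebra_simps)
      next
        case False
        then show ?thesis
          using 3 a q x leaf_step[of x] child[of x "leaf_step x"] anc_child[of x "leaf_step x" x\<^sub>0] g_le base_gain
          by (auto simp: s_eq \<pi>_def step k_def node_def)
      qed
    qed
  qed
  define B where "B = (1 - g) / \<rho>"
  have k_ge: "- B \<le> k s" if s: "s \<in> states" for s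
  proof -
    obtain q x where s_eq: "s = (q, x)" and x: "x < n" using s by auto
    have B: "0 \<le> B" using g_le \<rho> by (simp add: B_def)
    show ?thesis
    proof (cases "x \<noteq> G \<and> anc x x\<^sub>0")
      case True
      then have "dep x \<le> dep x\<^sub>0" using anc_dep x\<^sub>0 by simp
      then have "0 \<le> (real (dep x\<^sub>0) - real (dep x)) * (g - base_gain)" using g_ge by simp
      then show ?thesis using True by (simp add: s_eq k_def B_def)
    qed (use B in \<open>auto simp: s_eq k_def\<close>)
  qed
  have avg: "g - B / real m \<le> (\<integral>\<omega>. total_reward m \<omega> \<partial>traj) / real m" if "0 < m" for m
  proof -
    have "(\<Sum>w\<leftarrow>l. ?f w) = g * real m - (\<Sum>(s, a)\<leftarrow>l. reward s a)" if "length l = m" for l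
      using that by (simp add: sum_list_subtractf sum_list_triv case_prod_unfold)
    then have "measure_pmf.expectation (H m) (\<lambda>l. \<Sum>w\<leftarrow>l. ?f w) =
        measure_pmf.expectation (H m) (\<lambda>l. g * real m - (\<Sum>(s, a)\<leftarrow>l. reward s a))"
      by (intro integral_cong_AE AE_pmfI) (auto dest: length_hist_pmf)
    also have "\<dots> = g * real m - (\<integral>\<omega>. total_reward m \<omega> \<partial>traj)"
      unfolding expectation_total_reward
      by (subst Bochner_Integration.integral_diff) (auto intro: integrable_measure_pmf_finite[OF finite_H])
    finally have 1: "measure_pmf.expectation (H m) (\<lambda>l. \<Sum>w\<leftarrow>l. ?f w) = \<dots>" .
    have "measure_pmf.expectation (H (Suc m)) (\<lambda>l. - B) \<le> measure_pmf.expectation (H (Suc m)) (\<lambda>l. k (fst (last l)))"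
      using k_ge last_H(2) by (intro expectation_finite_mono finite_H) blast
    then have "- B \<le> measure_pmf.expectation (H (Suc m)) (\<lambda>l. k (fst (last l)))" by simp
    moreover have "measure_pmf.expectation (H m) (\<lambda>l. \<Sum>w\<leftarrow>l. ?f w) +
        measure_pmf.expectation (H (Suc m)) (\<lambda>l. k (fst (last l))) \<le> k ?s"
      by (rule potential_sum_le[OF k_step])
    moreover have "k ?s = 0" by (simp add: k_def)
    ultimately have "g * real m - B \<le> (\<integral>\<omega>. total_reward m \<omega> \<partial>traj)"
      unfolding 1 by linarith
    then have "(g * real m - B) / real m \<le> (\<integral>\<omega>. total_reward m \<omega> \<partial>traj) / real m"
      by (rule divide_right_mono) simp
    then show ?thesis using that by (simp add: diff_divide_distrib)
  qed
  let ?L = "\<lambda>\<pi>. liminf (\<lambda>m. ereal ((\<integral>\<omega>. total_reward m \<omega> \<partial>trajectory ?N \<pi> ?s) / real m))"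
  let ?S = "SUP \<pi>\<in>{\<pi>. decision_rule step_space {..<A} \<pi>}. ?L \<pi>"
  have "ereal g = liminf (\<lambda>m. ereal (g - B / real m))"
  proof (rule lim_imp_Liminf[symmetric])
    have "(\<lambda>m. g - B / real m) \<longlonglongrightarrow> g - 0"
      by (intro tendsto_diff tendsto_const lim_const_over_n)
    then show "(\<lambda>m. ereal (g - B / real m)) \<longlonglongrightarrow> ereal g" by simp
  qed simp
  also have "\<dots> \<le> ?L (stationary \<pi>)"
    by (intro Liminf_mono eventually_mono[OF eventually_gt_at_top[of 0]]) (simp add: avg)
  also have "\<dots> \<le> ?S" using stat by (intro SUP_upper) simp
  finally have lower: "ereal g \<le> ?S" .
  have "?L \<pi>' \<le> 1" if "decision_rule step_space {..<A} \<pi>'" for \<pi>'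
  proof -
    have "(\<integral>\<omega>. total_reward m \<omega> \<partial>trajectory ?N \<pi>' ?s) / real m \<le> 1" for m
      using total_reward_le[OF that s, where T=m and \<epsilon>=\<epsilon> and z="?z"] by (cases "m = 0") (simp_all add: field_simps)
    then have "?L \<pi>' \<le> liminf (\<lambda>m. 1 :: ereal)"
      by (intro Liminf_mono always_eventually) (simp add: one_ereal_def)
    then show ?thesis by (simp add: Liminf_const)
  qed
  \<comment> \<open>The lower bound alone would not do: \<open>real_of_ereal\<close> sends infinity
    to 0.\<close>
  then have "?S \<le> 1" by (intro SUP_least) simp
  then have "g \<le> real_of_ereal ?S"
    using lower by (cases ?S) (auto simp: one_ereal_def)
  then show ?thesis unfolding optimal_gain_def g_def \<rho>_def C_def by simp
qed

section \<open>Reward bounded through the use of the hidden pair\<close>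

definition arm_count :: "nat \<times> nat \<Rightarrow> ((nat \<times> nat) \<times> nat) list \<Rightarrow> real" where
  "arm_count z l = (\<Sum>w\<leftarrow>l. of_bool ((snd (fst w), snd w) = z))"

abbreviation "hist \<epsilon> z \<pi> s \<equiv> hist_pmf (det_kernel (cross \<epsilon> z) reward \<pi> s)"

lemma total_reward_le_arm_count:
  assumes p: "perturbation \<epsilon>" and rule: "decision_rule step_space {..<A} \<pi>" and q\<^sub>1: "q\<^sub>1 < Q"
  shows "(\<integral>\<omega>. total_reward T \<omega> \<partial>trajectory (cross \<epsilon> z) \<pi> (q\<^sub>1, G)) \<le>
    base_gain * real T + \<epsilon> * bias * measure_pmf.expectation (hist \<epsilon> z \<pi> (q\<^sub>1, G) T) (arm_count z)"
proof -
  have "(q\<^sub>1, G) \<in> states" using q\<^sub>1 G by simp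
  then interpret confined_mdp "cross \<epsilon> z" reward "{..<A}" \<pi> "(q\<^sub>1, G)" states "\<lambda>_. {..<A}"
    by (rule confined_rule[OF rule])
  define h where "h = (\<lambda>(q :: nat, x). if x = G then 0 else bias)"
  let ?f = "\<lambda>w. reward (fst w) (snd w) - base_gain - \<epsilon> * bias * of_bool ((snd (fst w), snd w) = z)"
  have h_step: "?f (s, a) + measure_pmf.expectation (mdp_trans (cross \<epsilon> z) s a) h \<le> h s"
    if s: "s \<in> states" and a: "a \<in> {..<A}" for s a
  proof -
    obtain q x where s_eq: "s = (q, x)" and x: "x < n" using s by auto
    have es: "0 \<le> \<epsilon> * bias" using p bias_pos by (simp add: perturbation_def)
    note step = expectation_trans_cross[OF p] reward_simps
    from x show ?thesis
    proof (cases rule: node_cases)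
      case 1
      then show ?thesis using es base_gain R
        by (cases "a = 0") (auto simp: s_eq step h_def node_def)
    next
      case 2
      then show ?thesis using base_gain(4)
        by (auto simp: s_eq step h_def rate_def algebra_simps)
    next
      case 3
      then show ?thesis using es child[of x a] a by (auto simp: s_eq step h_def node_def)
    qed
  qed
  note int = integrable_measure_pmf_finite[OF finite_H]
  have "measure_pmf.expectation (H T) (\<lambda>l. \<Sum>w\<leftarrow>l. ?f w) =
      measure_pmf.expectation (H T) (\<lambda>l. (\<Sum>(s, a)\<leftarrow>l. reward s a) - (base_gain * real T + \<epsilon> * bias * arm_count z l))"
    by (intro integral_cong_AE AE_pmfI)
       (auto dest!: length_hist_pmf simp: sum_list_subtractf sum_list_triv sum_list_const_mult arm_count_def case_prod_unfold)
  also have "\<dots> = (\<integral>\<omega>. total_reward T \<omega> \<partial>traj) -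
      (base_gain * real T + \<epsilon> * bias * measure_pmf.expectation (H T) (arm_count z))"
    unfolding expectation_total_reward Bochner_Integration.integral_diff[OF int int]
      Bochner_Integration.integral_add[OF int int] integral_mult_right_zero by simp
  finally have 1: "measure_pmf.expectation (H T) (\<lambda>l. \<Sum>w\<leftarrow>l. ?f w) = \<dots>" .
  have "0 \<le> measure_pmf.expectation (H (Suc T)) (\<lambda>l. h (fst (last l)))"
    using bias_pos by (intro Bochner_Integration.integral_nonneg) (auto simp: h_def split: prod.split)
  moreover have "measure_pmf.expectation (H T) (\<lambda>l. \<Sum>w\<leftarrow>l. ?f w) +
      measure_pmf.expectation (H (Suc T)) (\<lambda>l. h (fst (last l))) \<le> h (q\<^sub>1, G)"
    by (rule potential_sum_le[OF h_step])
  moreover have "h (q\<^sub>1, G) = 0" by (simp add: h_def)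
  ultimately show ?thesis unfolding 1 by linarith
qed

subsection \<open>Change of measure\<close>

text \<open>Chi-square divergence of the Bernoulli law with parameter \<delta> from that with
  parameter \<open>\<delta> - \<epsilon>\<close>.\<close>

definition chi_sq :: "real \<Rightarrow> real" where
  "chi_sq \<epsilon> = \<epsilon>\<^sup>2 / ((\<delta> - \<epsilon>) * (1 - \<delta> + \<epsilon>))"

text \<open>With \<epsilon> = 0 the hidden pair leaves no trace, so every \<open>z'\<close> names
  the same reference process.\<close>

lemma obs_tr_eq: "(x, a) \<noteq> z \<Longrightarrow> obs_tr \<epsilon> z x a = obs_tr 0 z' x a"
  by (auto simp: obs_tr_def rate_def)

lemma trans_chi_sq:
  fixes q :: nat and z' :: "nat \<times> nat"
  assumes p: "perturbation \<epsilon>" and z: "(x, a) \<in> arms"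
  defines "P \<equiv> mdp_trans (cross 0 z') (q, x) a" and "P' \<equiv> mdp_trans (cross \<epsilon> (x, a)) (q, x) a"
  shows "set_pmf P \<subseteq> set_pmf P'"
    and "measure_pmf.expectation P (\<lambda>s. pmf P s / pmf P' s) = 1 + chi_sq \<epsilon>"
proof -
  have x: "node x" "leaf x" using z by (auto simp: arms_def)
  have \<rho>: "0 < \<delta> - \<epsilon>" "0 \<le> \<epsilon>" "0 < 1 - \<delta> + \<epsilon>" using p \<delta> by (auto simp: perturbation_def)
  have inj: "inj (Pair q :: nat \<Rightarrow> nat \<times> nat)" by (auto simp: inj_def)
  have lab: "rm_tr q (lab x a) = q" using x by (auto simp: lab_def rm_tr_def node_def)
  have P: "P = map_pmf (Pair q) (mix_pmf \<delta> G x)" "P' = map_pmf (Pair q) (mix_pmf (\<delta> - \<epsilon>) G x)"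
    using x unfolding P_def P'_def trans_cross lab
    by (auto simp: obs_tr_def node_def rate_def)
  show "set_pmf P \<subseteq> set_pmf P'"
    using \<rho> \<delta> by (auto simp: P mix_pmf_def)
  have Gx: "G \<noteq> x" using x by (auto simp: node_def)
  have "measure_pmf.expectation P (\<lambda>s. pmf P s / pmf P' s) =
      \<delta> * (\<delta> / (\<delta> - \<epsilon>)) + (1 - \<delta>) * ((1 - \<delta>) / (1 - (\<delta> - \<epsilon>)))"
    using \<delta> \<rho> Gx unfolding P
    by (simp add: expectation_mix_pmf pmf_map_inj'[OF inj] pmf_mix_pmf)
  also have "\<dots> = 1 + chi_sq \<epsilon>"
    using \<rho> unfolding chi_sq_def by (simp add: divide_simps) (simp add: algebra_simps power2_eq_square)
  finally show "measure_pmf.expectation P (\<lambda>s. pmf P s / pmf P' s) = 1 + chi_sq \<epsilon>" .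
qed

text \<open>Given the same history, the learner draws its action from the same law in both
  processes, so its choice cancels in the likelihood ratio. The transition differs only if the last
  recorded pair is the hidden one.\<close>

lemma det_kernel_chi_sq:
  fixes z' :: "nat \<times> nat"
  assumes p: "perturbation \<epsilon>" and z: "z \<in> arms"
    and rule: "decision_rule step_space {..<A} \<pi>" and s\<^sub>1: "s\<^sub>1 \<in> states"
  defines "K \<equiv> det_kernel (cross 0 z') reward \<pi> s\<^sub>1" and "K' \<equiv> det_kernel (cross \<epsilon> z) reward \<pi> s\<^sub>1"
  shows "set_pmf (K l) \<subseteq> set_pmf (K' l)"
    and "measure_pmf.expectation (K l) (\<lambda>w. pmf (K l) w / pmf (K' l) w) - 1 =
      chi_sq \<epsilon> * of_bool (l \<noteq> [] \<and> (snd (fst (last l)), snd (last l)) = z)"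
proof -
  interpret C: confined_mdp "cross 0 z'" reward "{..<A}" \<pi> s\<^sub>1 states "\<lambda>_. {..<A}"
    by (rule confined_rule[OF rule s\<^sub>1])
  interpret C': confined_mdp "cross \<epsilon> z" reward "{..<A}" \<pi> s\<^sub>1 states "\<lambda>_. {..<A}"
    by (rule confined_rule[OF rule s\<^sub>1])
  let ?P = "C.next_pmf l" and ?P' = "C'.next_pmf l"
  let ?r = "\<pi> (length l) (det_hist reward (length l) l)"
  have K: "K l = bind_pmf ?P (\<lambda>s. map_pmf (Pair s) (?r s))" unfolding K_def by (rule C.K_eq)
  have K': "K' l = bind_pmf ?P' (\<lambda>s. map_pmf (Pair s) (?r s))" unfolding K'_def by (rule C'.K_eq)
  have P: "set_pmf ?P \<subseteq> set_pmf ?P' \<and> measure_pmf.expectation ?P (\<lambda>s. pmf ?P s / pmf ?P' s) =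
      1 + chi_sq \<epsilon> * of_bool (l \<noteq> [] \<and> (snd (fst (last l)), snd (last l)) = z)"
  proof (cases "l \<noteq> [] \<and> (snd (fst (last l)), snd (last l)) = z")
    case True
    obtain q x a where l: "last l = ((q, x), a)" by (metis prod.exhaust)
    with True have "z = (x, a)" by simp
    with True l show ?thesis using trans_chi_sq[OF p, where x=x and a=a and z'=z' and q=q] z by simp
  next
    case False
    obtain q x a where l: "last l = ((q, x), a)" by (metis prod.exhaust)
    have eq: "?P = ?P'" using False l obs_tr_eq[of x a z \<epsilon> z'] by (auto simp: trans_cross)
    have "measure_pmf.expectation ?P (\<lambda>s. pmf ?P s / pmf ?P' s) = measure_pmf.expectation ?P (\<lambda>s. 1)"
      unfolding eq by (intro integral_cong_AE AE_pmfI) (auto simp: set_pmf_iff)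
    then show ?thesis using False eq by simp
  qed
  show "set_pmf (K l) \<subseteq> set_pmf (K' l)" using P unfolding K K' set_bind_pmf by blast
  have "measure_pmf.expectation (K l) (\<lambda>w. pmf (K l) w / pmf (K' l) w) =
      measure_pmf.expectation (K l) (\<lambda>w. pmf ?P (fst w) / pmf ?P' (fst w))"
  proof (intro integral_cong_AE AE_pmfI)
    fix w assume w: "w \<in> set_pmf (K l)"
    obtain s a where w_eq: "w = (s, a)" by fastforce
    have "pmf (K l) w \<noteq> 0" using w by (simp add: set_pmf_iff)
    then have "pmf (?r s) a \<noteq> 0" unfolding K w_eq pmf_bind_map_Pair by simp
    then show "pmf (K l) w / pmf (K' l) w = pmf ?P (fst w) / pmf ?P' (fst w)"
      unfolding K K' w_eq pmf_bind_map_Pair by simp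
  qed auto
  also have "\<dots> = measure_pmf.expectation ?P (\<lambda>s. pmf ?P s / pmf ?P' s)"
    unfolding K_def by (rule C.expectation_fst_K)
  finally show "measure_pmf.expectation (K l) (\<lambda>w. pmf (K l) w / pmf (K' l) w) - 1 =
      chi_sq \<epsilon> * of_bool (l \<noteq> [] \<and> (snd (fst (last l)), snd (last l)) = z)"
    using P by simp
qed

lemma arm_count_bounds: "0 \<le> arm_count z l" "arm_count z l \<le> real (length l)"
  unfolding arm_count_def by (induction l) auto

text \<open>The reference process is the first argument of the relative entropy, which makes the
  bound a multiple of the expected count under that process, the quantity that averaging over the
  arms controls.\<close>

lemma arm_count_change_of_measure:
  fixes z' :: "nat \<times> nat" and T :: nat
  assumes p: "perturbation \<epsilon>" and z: "z \<in> arms"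
    and rule: "decision_rule step_space {..<A} \<pi>" and s\<^sub>1: "s\<^sub>1 \<in> states"
  defines "e \<equiv> measure_pmf.expectation (hist 0 z' \<pi> s\<^sub>1 T) (arm_count z)"
  shows "measure_pmf.expectation (hist \<epsilon> z \<pi> s\<^sub>1 T) (arm_count z) \<le> e + real T * sqrt (chi_sq \<epsilon> * e)"
proof -
  interpret C: confined_mdp "cross 0 z'" reward "{..<A}" \<pi> s\<^sub>1 states "\<lambda>_. {..<A}"
    by (rule confined_rule[OF rule s\<^sub>1])
  interpret C': confined_mdp "cross \<epsilon> z" reward "{..<A}" \<pi> s\<^sub>1 states "\<lambda>_. {..<A}"
    by (rule confined_rule[OF rule s\<^sub>1])
  note chi = det_kernel_chi_sq[OF p z rule s\<^sub>1, where z'=z']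
  let ?u = "\<lambda>t. measure_pmf.expectation (C.H t)
    (\<lambda>l. of_bool (l \<noteq> [] \<and> (snd (fst (last l)), snd (last l)) = z) :: real)"
  have chi_pos: "0 \<le> chi_sq \<epsilon>" using p \<delta> by (simp add: chi_sq_def perturbation_def)
  have count: "measure_pmf.expectation (C.H t) (arm_count z) = (\<Sum>i<t. ?u (Suc i))" for t
  proof (induction t)
    case 0
    then show ?case by (simp add: arm_count_def)
  next
    case (Suc t)
    note int = integrable_measure_pmf_finite[OF C.finite_H]
    have "measure_pmf.expectation (C.H (Suc t)) (arm_count z) = measure_pmf.expectation (C.H (Suc t))
        (\<lambda>l. arm_count z (butlast l) + of_bool (l \<noteq> [] \<and> (snd (fst (last l)), snd (last l)) = z))"
    proof (intro integral_cong_AE AE_pmfI)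
      fix l assume "l \<in> set_pmf (C.H (Suc t))"
      then have "l \<noteq> []" by (rule C.last_H)
      then show "arm_count z l = arm_count z (butlast l) +
          of_bool (l \<noteq> [] \<and> (snd (fst (last l)), snd (last l)) = z)"
        by (cases l rule: rev_cases) (auto simp: arm_count_def)
    qed auto
    also have "\<dots> = measure_pmf.expectation (C.H (Suc t)) (\<lambda>l. arm_count z (butlast l)) + ?u (Suc t)"
      by (rule Bochner_Integration.integral_add[OF int int])
    also have "measure_pmf.expectation (C.H (Suc t)) (\<lambda>l. arm_count z (butlast l)) =
        measure_pmf.expectation (C.H t) (arm_count z)"
      by (subst C.expectation_last_H[where g="\<lambda>l _. arm_count z l"]) simp
    finally show ?case by (simp only: Suc.IH sum.lessThan_Suc)
  qed
  \<comment> \<open>\<open>?u t\<close> concerns the pair played in round \<open>t - 1\<close>,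
    whose outcome is seen in round \<open>t\<close>. The pair of the final round never shows its
    outcome within the horizon.\<close>
  have "(\<Sum>t<T. ?u t) \<le> (\<Sum>t<Suc T. ?u t)" by simp
  also have "\<dots> = ?u 0 + (\<Sum>t<T. ?u (Suc t))" by (rule sum.lessThan_Suc_shift)
  also have "\<dots> = e" unfolding e_def count by simp
  finally have u: "(\<Sum>t<T. ?u t) \<le> e" .
  have "measure_pmf.expectation (C.H T) (\<lambda>l. ln (pmf (C.H T) l / pmf (C'.H T) l)) \<le>
      (\<Sum>t<T. measure_pmf.expectation (C.H t)
        (\<lambda>l. measure_pmf.expectation (C.K l) (\<lambda>w. pmf (C.K l) w / pmf (C'.K l) w) - 1))"
    by (rule KL_hist_pmf_le[OF C.finite_K chi(1)])
  also have "\<dots> = chi_sq \<epsilon> * (\<Sum>t<T. ?u t)"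
    unfolding chi(2) integral_mult_right_zero by (simp add: sum_distrib_left)
  also have "\<dots> \<le> chi_sq \<epsilon> * e" using u chi_pos by (rule mult_left_mono)
  finally have KL: "measure_pmf.expectation (C.H T) (\<lambda>l. ln (pmf (C.H T) l / pmf (C'.H T) l)) \<le> \<dots>" .
  show ?thesis
    unfolding e_def
  proof (rule expectation_diff_le_KL[OF C.finite_H C'.finite_H _ _ _ KL[unfolded e_def]])
    show "set_pmf (C.H T) \<subseteq> set_pmf (C'.H T)" by (rule set_hist_pmf_mono[OF chi(1)])
    show "arm_count z l \<le> real T" if "l \<in> set_pmf (C'.H T)" for l
      using arm_count_bounds(2)[of z l] length_hist_pmf[OF that] by simp
  qed (rule arm_count_bounds(1))
qed

section \<open>A rarely used pair and the regret it causes\<close>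

lemma finite_arms: "finite arms"
  using finite_nodes by (auto simp: arms_def intro: finite_subset[of _ "{x. node x}"])

text \<open>Pigeonhole: a round uses at most one pair, so the expected counts add up to at most
  \<open>T\<close>.\<close>

lemma exists_rare_arm:
  assumes rule: "decision_rule step_space {..<A} \<pi>" and s\<^sub>1: "s\<^sub>1 \<in> states" and ne: "arms \<noteq> {}"
  shows "\<exists>z\<in>arms. measure_pmf.expectation (hist 0 z' \<pi> s\<^sub>1 T) (arm_count z) \<le> real T / real (card arms)"
proof (rule ccontr)
  interpret C: confined_mdp "cross 0 z'" reward "{..<A}" \<pi> s\<^sub>1 states "\<lambda>_. {..<A}"
    by (rule confined_rule[OF rule s\<^sub>1])
  assume "\<not> ?thesis"
  then have "\<And>z. z \<in> arms \<Longrightarrow> real T / real (card arms) < measure_pmf.expectation (C.H T) (arm_count z)"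
    by force
  then have "(\<Sum>z\<in>arms. real T / real (card arms)) < (\<Sum>z\<in>arms. measure_pmf.expectation (C.H T) (arm_count z))"
    using finite_arms ne by (intro sum_strict_mono)
  also have "\<dots> = measure_pmf.expectation (C.H T) (\<lambda>l. \<Sum>z\<in>arms. arm_count z l)"
    by (rule Bochner_Integration.integral_sum[symmetric]) (rule integrable_measure_pmf_finite[OF C.finite_H])
  also have "\<dots> \<le> measure_pmf.expectation (C.H T) (\<lambda>l. real T)"
  proof (intro expectation_finite_mono C.finite_H)
    fix l assume "l \<in> set_pmf (C.H T)"
    then have l: "length l = T" by (rule length_hist_pmf)
    have "(\<Sum>z\<in>arms. arm_count z l) \<le> real (length l)"
    proof (induction l)
      case (Cons w l)
      have "(\<Sum>z\<in>arms. arm_count z (w # l)) =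
          (\<Sum>z\<in>arms. of_bool ((snd (fst w), snd w) = z)) + (\<Sum>z\<in>arms. arm_count z l)"
        by (simp add: arm_count_def sum.distrib)
      moreover have "(\<Sum>z\<in>arms. of_bool ((snd (fst w), snd w) = z)) \<le> (1 :: real)"
        using finite_arms by (simp add: of_bool_def)
      ultimately show ?case using Cons by simp
    qed (simp add: arm_count_def)
    then show "(\<Sum>z\<in>arms. arm_count z l) \<le> real T" by (simp add: l)
  qed
  finally show False using finite_arms ne by simp
qed

text \<open>In the bracket stand the informed policy's share of rounds at the hidden pair, the
  learner's share in the reference process, and the most that this share can grow once the pair is
  hidden there.\<close>

lemma expected_regret_ge:
  assumes p: "perturbation \<epsilon>" and ne: "arms \<noteq> {}" and alg: "learning_algorithm {..<A} alg" and q\<^sub>1: "q\<^sub>1 < Q"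
  defines "\<kappa> \<equiv> real (card arms)"
  shows "\<exists>z\<in>arms. \<epsilon> * bias * real T *
      (1 / ((\<delta> - \<epsilon>) * cycle \<epsilon> (fst z)) - 1 / \<kappa> - sqrt (chi_sq \<epsilon> * (real T / \<kappa>)))
    \<le> expected_regret (member \<epsilon> z) alg (q\<^sub>1, G) T"
proof -
  define \<pi> where "\<pi> = (\<lambda>t h s. alg t (\<lambda>i\<in>{0..<t}. observe (member 0 (0, 0)) (h i)) s)"
  have s: "(q\<^sub>1, G) \<in> states" using q\<^sub>1 G by simp
  \<comment> \<open>Labels do not depend on \<epsilon> or \<open>z\<close>, so a learner induces the
    same decision rule in all members.\<close>
  have obs: "observe (member \<epsilon> z) = observe (member 0 (0, 0))" for z
    by (simp add: observe_def)
  have rule: "decision_rule step_space {..<A} \<pi>"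
    unfolding \<pi>_def by (rule decision_rule_learner[OF alg])
  obtain z where z: "z \<in> arms"
    and rare: "measure_pmf.expectation (hist 0 (0, 0) \<pi> (q\<^sub>1, G) T) (arm_count z) \<le> real T / \<kappa>"
    using exists_rare_arm[OF rule s ne] unfolding \<kappa>_def by blast
  interpret confined_mdp "cross \<epsilon> z" reward "{..<A}" \<pi> "(q\<^sub>1, G)" states "\<lambda>_. {..<A}"
    by (rule confined_rule[OF rule s])
  interpret traj: prob_space traj by (rule prob_space_traj)
  let ?g = "optimal_gain (cross \<epsilon> z) (q\<^sub>1, G)"
  have chi_pos: "0 \<le> chi_sq \<epsilon>" using p \<delta> by (simp add: chi_sq_def perturbation_def)
  have "measure_pmf.expectation (H T) (arm_count z) \<le> real T / \<kappa> + real T * sqrt (chi_sq \<epsilon> * (real T / \<kappa>))"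
    using arm_count_change_of_measure[OF p z rule s, where z'="(0, 0)" and T=T] rare chi_pos
    by (elim order_trans) (intro add_mono mult_left_mono real_sqrt_le_mono, auto)
  moreover have es: "0 \<le> \<epsilon> * bias" using p bias_pos by (simp add: perturbation_def)
  ultimately have "\<epsilon> * bias * measure_pmf.expectation (H T) (arm_count z) \<le>
      \<epsilon> * bias * (real T / \<kappa> + real T * sqrt (chi_sq \<epsilon> * (real T / \<kappa>)))"
    by (rule mult_left_mono)
  with total_reward_le_arm_count[OF p rule q\<^sub>1, where T=T and z=z]
  have "(\<integral>\<omega>. total_reward T \<omega> \<partial>traj) \<le>
      base_gain * real T + \<epsilon> * bias * (real T / \<kappa> + real T * sqrt (chi_sq \<epsilon> * (real T / \<kappa>)))" by linarith
  moreover have "real T * (base_gain + \<epsilon> * bias / ((\<delta> - \<epsilon>) * cycle \<epsilon> (fst z))) \<le> real T * ?g"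
    using optimal_gain_ge[OF p, of "fst z" "snd z" q\<^sub>1] z q\<^sub>1 by (intro mult_left_mono) auto
  moreover have "expected_regret (member \<epsilon> z) alg (q\<^sub>1, G) T = real T * ?g - (\<integral>\<omega>. total_reward T \<omega> \<partial>traj)"
    unfolding expected_regret_def interaction_def regret_def obs \<pi>_def[symmetric]
    by (subst Bochner_Integration.integral_diff[OF _ integrable_total_reward]) (simp_all add: traj.prob_space)
  ultimately have "real T * (base_gain + \<epsilon> * bias / ((\<delta> - \<epsilon>) * cycle \<epsilon> (fst z))) -
      (base_gain * real T + \<epsilon> * bias * (real T / \<kappa> + real T * sqrt (chi_sq \<epsilon> * (real T / \<kappa>)))) \<le>
      expected_regret (member \<epsilon> z) alg (q\<^sub>1, G) T" by linarith
  then show ?thesis using z by (intro bexI[of _ z]) (simp_all add: algebra_simps)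
qed

end

context nav_tree
begin

text \<open>Descending from \<open>x\<close> to a nearest leaf takes \<open>hgt x\<close> steps and
  ends at depth \<open>dep x + hgt x\<close>.\<close>

lemma hmax_le_dmax: "hmax \<le> dmax"
proof -
  have "\<exists>y. node y \<and> dep y = dep x + hgt x" if "node x" for x
    using that
  proof (induction "hgt x" arbitrary: x)
    case 0
    then show ?case by auto
  next
    case (Suc k)
    then have "inner x" using hgt_leaf by (auto simp: inner_def)
    then obtain a where a: "a < A" "hgt x = Suc (hgt (child x a))" using hgt_child_ex by blast
    then show ?case
      using Suc.hyps Suc(1)[of "child x a"] child[OF \<open>inner x\<close> a(1)] dep_child[OF \<open>inner x\<close> a(1)] by auto
  qed
  moreover obtain x where "node x" "hgt x = hmax" using hmax_attained by blast
  ultimately show ?thesis using dep_le by (metis le_add2 le_trans)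
qed

end

subsection \<open>Heap-ordered trees\<close>

text \<open>Label 0 stands for \<open>G\<close>; the labels \<open>1, ..., n - 1\<close> form a heap
  with root 1 in which \<open>v\<close> has the children
  \<open>A * (v - 1) + 2, ..., A * v + 1\<close>.\<close>

locale heap =
  fixes n A :: nat
  assumes n: "3 \<le> n" and A: "2 \<le> A"
begin

definition hleaf :: "nat \<Rightarrow> bool" where "hleaf v \<longleftrightarrow> n \<le> A * (v - 1) + 2"

text \<open>The last inner node may have fewer than \<open>A\<close> children; its surplus actions
  lead to \<open>n - 1\<close>, which is one of them.\<close>

definition hchild :: "nat \<Rightarrow> nat \<Rightarrow> nat" where "hchild v a = min (A * (v - 1) + 2 + a) (n - 1)"

definition hpar :: "nat \<Rightarrow> nat" where "hpar v = (v - 2) div A + 1"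

function hdep :: "nat \<Rightarrow> nat" where
  "hdep v = (if v \<le> 1 then 0 else Suc (hdep (hpar v)))"
  by auto
termination
proof (relation "Wellfounded.measure id")
  fix v :: nat assume "\<not> v \<le> 1"
  moreover have "(v - 2) div A \<le> v - 2" by (rule div_le_dividend)
  ultimately have "hpar v < v" unfolding hpar_def by linarith
  then show "(hpar v, v) \<in> Wellfounded.measure id" by simp
qed simp

declare hdep.simps [simp del]

text \<open>Recursion on the level instead of the node: the height, as a least level, then needs no
  termination argument.\<close>

primrec leaf_in :: "nat \<Rightarrow> nat \<Rightarrow> bool" where
  "leaf_in 0 v \<longleftrightarrow> hleaf v"
| "leaf_in (Suc k) v \<longleftrightarrow> \<not> hleaf v \<and> (\<exists>a<A. leaf_in k (hchild v a))"

definition hhgt :: "nat \<Rightarrow> nat" where "hhgt v = (LEAST k. leaf_in k v)"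

text \<open>Truncated subtraction makes \<open>hpar\<close> fix the root 1, so iterating too often
  does no harm.\<close>

definition hanc :: "nat \<Rightarrow> nat \<Rightarrow> bool" where "hanc v w \<longleftrightarrow> (\<exists>k. (hpar ^^ k) w = v)"

lemma hchild:
  assumes "1 \<le> v" "\<not> hleaf v" "a < A"
  shows "hchild v a < n" "v < hchild v a" "2 \<le> hchild v a" "hpar (hchild v a) = v" "Suc 0 \<le> hchild v a"
proof -
  have nl: "A * (v - 1) + 2 < n" using assms by (simp add: hleaf_def)
  have "2 * (v - 1) \<le> A * (v - 1)" using A by simp
  then have "v < A * (v - 1) + 2" by linarith
  then show "hchild v a < n" "v < hchild v a" "2 \<le> hchild v a" "Suc 0 \<le> hchild v a"
    using nl unfolding hchild_def by linarith+
  have "(hchild v a - 2) div A = v - 1"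
  proof (rule div_nat_eqI)
    show "A * (v - 1) \<le> hchild v a - 2" using nl by (auto simp: hchild_def)
    show "hchild v a - 2 < A * Suc (v - 1)"
      using nl assms(3) unfolding hchild_def mult_Suc_right by linarith
  qed
  then show "hpar (hchild v a) = v" using assms by (simp add: hpar_def)
qed

lemma hpar_range: "1 \<le> hpar v" "1 \<le> v \<Longrightarrow> hpar v \<le> v" "2 \<le> v \<Longrightarrow> hpar v < v"
  using div_le_dividend[of "v - 2" A] unfolding hpar_def by linarith+

lemma hchild_hpar:
  assumes "2 \<le> v" "v < n"
  shows "\<not> hleaf (hpar v)" "\<exists>a<A. hchild (hpar v) a = v"
proof -
  have v: "A * (hpar v - 1) + 2 + (v - 2) mod A = v"
    using assms mult_div_mod_eq[of A "v - 2"] by (simp add: hpar_def)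
  then show "\<not> hleaf (hpar v)" using assms by (simp add: hleaf_def)
  have "hchild (hpar v) ((v - 2) mod A) = v" using v assms by (simp add: hchild_def)
  then show "\<exists>a<A. hchild (hpar v) a = v" using A by (intro exI[of _ "(v - 2) mod A"]) auto
qed

lemma hpar_funpow_range: "1 \<le> v \<Longrightarrow> 1 \<le> (hpar ^^ k) v \<and> (hpar ^^ k) v \<le> v"
  using hpar_range by (induction k) (auto intro: order_trans)

lemma hdep_hpar: "2 \<le> v \<Longrightarrow> hdep v = Suc (hdep (hpar v))"
  by (subst hdep.simps) simp

lemma hdep_1: "hdep (Suc 0) = 0"
  by (subst hdep.simps) simp

lemma hdep_hpar_le: "1 \<le> v \<Longrightarrow> hdep (hpar v) \<le> hdep v"
  using hdep_hpar[of v] by (cases "v = 1") (auto simp: hpar_def hdep_1)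

lemma hdep_funpow_le: "1 \<le> v \<Longrightarrow> hdep ((hpar ^^ k) v) \<le> hdep v"
proof (induction k)
  case (Suc k)
  then show ?case using hdep_hpar_le[of "(hpar ^^ k) v"] hpar_funpow_range[of v k] by simp
qed simp

lemma hanc_1:
  assumes "1 \<le> v"
  shows "hanc 1 v"
  using assms
proof (induction v rule: less_induct)
  case (less v)
  show ?case
  proof (cases "v = 1")
    case True
    then show ?thesis unfolding hanc_def by (intro exI[of _ 0]) simp
  next
    case False
    with less.prems have "hpar v < v" using hpar_range(3) by simp
    from less.IH[OF this hpar_range(1)] obtain k where "(hpar ^^ k) (hpar v) = 1" by (auto simp: hanc_def)
    then have "(hpar ^^ Suc k) v = 1" by (simp add: funpow_swap1)
    then show ?thesis unfolding hanc_def by blast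
  qed
qed

text \<open>With the least number of iterations, the node just below \<open>v\<close> on the path
  differs from \<open>v\<close>; this excludes the loop at the root.\<close>

lemma hanc_cases:
  assumes "hanc v w" "v \<noteq> w" "1 \<le> w"
  obtains u where "hanc u w" "hpar u = v" "2 \<le> u" "u \<le> w"
proof -
  define k where "k = (LEAST k. (hpar ^^ k) w = v)"
  have k: "(hpar ^^ k) w = v"
    unfolding k_def using assms(1) unfolding hanc_def by (rule LeastI_ex)
  then obtain j where j: "k = Suc j" using assms(2) by (cases k) auto
  let ?u = "(hpar ^^ j) w"
  have "?u \<noteq> v" using not_less_Least[of j "\<lambda>k. (hpar ^^ k) w = v"] j by (simp add: k_def)
  moreover have "hpar ?u = v" using k j by simp
  moreover have "1 \<le> ?u" "?u \<le> w" using hpar_funpow_range[OF assms(3)] by auto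
  moreover have "?u \<noteq> 1" using calculation by (auto simp: hpar_def)
  ultimately show ?thesis by (intro that[of ?u]) (auto simp: hanc_def)
qed

lemma leaf_in_ex: "1 \<le> v \<Longrightarrow> v < n \<Longrightarrow> \<exists>k. leaf_in k v"
proof (induction "n - v" arbitrary: v rule: less_induct)
  case less
  show ?case
  proof (cases "hleaf v")
    case True
    then show ?thesis by (intro exI[of _ 0]) simp
  next
    case False
    have "0 < A" using A by simp
    note c = hchild[OF less.prems(1) False this]
    have "\<exists>k. leaf_in k (hchild v 0)"
      by (rule less.hyps) (use c less.prems in linarith)+
    then obtain k where "leaf_in k (hchild v 0)" by blast
    then show ?thesis using False \<open>0 < A\<close> by (intro exI[of _ "Suc k"]) auto
  qed
qed

lemma leaf_in_hhgt: "1 \<le> v \<Longrightarrow> v < n \<Longrightarrow> leaf_in (hhgt v) v"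
  unfolding hhgt_def using leaf_in_ex by (rule LeastI_ex)

lemma hhgt_le: "leaf_in k v \<Longrightarrow> hhgt v \<le> k"
  unfolding hhgt_def by (rule Least_le)

lemma hhgt_child:
  assumes "1 \<le> v" "\<not> hleaf v"
  shows "a < A \<Longrightarrow> hhgt v \<le> Suc (hhgt (hchild v a))" "v < n \<Longrightarrow> \<exists>a<A. hhgt v = Suc (hhgt (hchild v a))"
proof -
  show le: "hhgt v \<le> Suc (hhgt (hchild v a))" if "a < A" for a
    using leaf_in_hhgt[of "hchild v a"] hchild[OF assms that] assms that by (intro hhgt_le) auto
  assume "v < n"
  then have lv: "leaf_in (hhgt v) v" using assms leaf_in_hhgt by blast
  then obtain k where k: "hhgt v = Suc k" using assms by (cases "hhgt v") auto
  then obtain a where a: "a < A" "leaf_in k (hchild v a)" using lv by auto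
  then show "\<exists>a<A. hhgt v = Suc (hhgt (hchild v a))"
    using hhgt_le[OF a(2)] le[OF a(1)] k by (intro exI[of _ a]) auto
qed

text \<open>\<open>hpar v - 1\<close> is \<open>(v - 2) div A\<close>, so each level costs a factor
  \<open>A\<close>.\<close>

lemma power_hdep_le: "2 \<le> v \<Longrightarrow> A ^ (hdep v - 1) \<le> v - 1"
proof (induction v rule: less_induct)
  case (less v)
  show ?case
  proof (cases "hpar v = 1")
    case True
    then show ?thesis using less.prems by (simp add: hdep_hpar hdep_1)
  next
    case False
    then have p: "2 \<le> hpar v" using hpar_range(1)[of v] by simp
    then have "A ^ (hdep (hpar v) - 1) \<le> hpar v - 1"
      using less hpar_range(3) by simp
    also have "hpar v - 1 = (v - 2) div A" by (simp add: hpar_def)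
    finally have "A ^ (hdep (hpar v) - 1) * A \<le> (v - 2) div A * A" by simp
    also have "\<dots> \<le> v - 2" by (rule div_times_less_eq_dividend)
    finally have "A ^ Suc (hdep (hpar v) - 1) \<le> v - 2" by (simp add: mult.commute)
    moreover have "Suc (hdep (hpar v) - 1) = hdep v - 1"
      using p less.prems hdep_hpar[of v] hdep_hpar[of "hpar v"] by simp
    ultimately have "A ^ (hdep v - 1) \<le> v - 2" by (simp only:)
    then show ?thesis by linarith
  qed
qed

lemma hdep_le_log:
  assumes "1 \<le> v" "v < n"
  shows "real (hdep v) \<le> 1 + log (real A) (real n)"
proof (cases "v = 1")
  case True
  then show ?thesis using n A by (simp add: hdep_1 zero_le_log_cancel_iff add_nonneg_nonneg)
next
  case False
  then have "A ^ (hdep v - 1) \<le> n" using power_hdep_le[of v] assms by simp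
  then have "real A ^ (hdep v - 1) \<le> real n" by (metis of_nat_le_iff of_nat_power)
  then have "real (hdep v - 1) \<le> log (real A) (real n)"
    using A n by (intro le_log_of_power) auto
  then show ?thesis by linarith
qed

text \<open>For three observation states the logarithmic bound would be too weak for the constants
  chosen below.\<close>

lemma hdep_le_1:
  assumes "n = 3" "1 \<le> v" "v < n"
  shows "hdep v \<le> 1"
proof (cases "v = 1")
  case False
  then have "v = 2" using assms by simp
  then show ?thesis using hdep_hpar[of 2] by (simp add: hpar_def hdep_1)
qed (simp add: hdep_1)

text \<open>As \<open>2 \<le> A\<close>, a label \<open>v\<close> with \<open>n \<le> 2 * v\<close>
  has no child.\<close>

lemma card_leaves:
  "n div 2 \<le> card {v. 1 \<le> v \<and> v < n \<and> hleaf v}"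
proof -
  have "hleaf v" if "n - n div 2 \<le> v" for v
  proof -
    have "2 * (v - 1) \<le> A * (v - 1)" using A by simp
    then show ?thesis using that n unfolding hleaf_def by linarith
  qed
  then have "{n - n div 2..<n} \<subseteq> {v. 1 \<le> v \<and> v < n \<and> hleaf v}" using n by auto
  then have "card {n - n div 2..<n} \<le> card {v. 1 \<le> v \<and> v < n \<and> hleaf v}"
    by (intro card_mono) auto
  then show ?thesis by simp
qed

section \<open>Exchanging the labels 0 and \<open>r\<close>\<close>

definition relabel :: "nat \<Rightarrow> nat \<Rightarrow> nat" where
  "relabel r x = (if x = 0 then r else if x = r then 0 else x)"

lemma relabel_relabel [simp]: "relabel r (relabel r x) = x"
  by (simp add: relabel_def)

lemma relabel_less: "r < n \<Longrightarrow> relabel r x < n \<longleftrightarrow> x < n"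
  using n by (auto simp: relabel_def)

lemma relabel_eq_0: "1 \<le> relabel r x \<longleftrightarrow> x \<noteq> r"
  by (auto simp: relabel_def)

lemma relabel_inj: "relabel r x = relabel r y \<longleftrightarrow> x = y"
  by (metis relabel_relabel)

text \<open>The exchange is an involution, so each axiom is a fact on the heap read through
  \<open>relabel r\<close>, with \<open>r\<close> in the part of 0.\<close>

lemma nav_tree_relabel:
  assumes r: "r < n"
  shows "nav_tree n A r (\<lambda>x. hleaf (relabel r x)) (relabel r 1)
    (\<lambda>x a. relabel r (hchild (relabel r x) a)) (\<lambda>x. hdep (relabel r x)) (\<lambda>x. hhgt (relabel r x))
    (\<lambda>x y. hanc (relabel r x) (relabel r y))"
proof -
  interpret nav_nodes n A r "\<lambda>x. hleaf (relabel r x)" .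
  have node: "node x \<longleftrightarrow> 1 \<le> relabel r x \<and> relabel r x < n" for x
    using r by (simp only: node_def relabel_less relabel_eq_0) blast
  show ?thesis
  proof unfold_locales
    show "\<exists>a<A. hhgt (relabel r x) = Suc (hhgt (relabel r (relabel r (hchild (relabel r x) a))))" if "inner x" for x
      using hhgt_child(2)[of "relabel r x"] that by (auto simp: inner_def node)
    show "hhgt (relabel r x) \<le> Suc (hhgt (relabel r (relabel r (hchild (relabel r x) a))))"
      if "inner x" "a < A" for x a
      using hhgt_child(1)[of "relabel r x" a] that by (auto simp: inner_def node)
    show "hhgt (relabel r x) = 0" if "hleaf (relabel r x)" for x
      using hhgt_le[of 0 "relabel r x"] that by simp
    show "hanc (relabel r x) (relabel r x)" for x
      unfolding hanc_def by (intro exI[of _ 0]) simp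
    show "hanc (relabel r (relabel r 1)) (relabel r x)" if "node x" for x
      using hanc_1[of "relabel r x"] that by (simp add: node)
    show "x = y" if "node x" "hleaf (relabel r x)" "node y" "hanc (relabel r x) (relabel r y)" for x y
    proof (rule ccontr)
      assume "x \<noteq> y"
      then have ne: "relabel r x \<noteq> relabel r y" by (simp add: relabel_inj)
      show False
      proof (rule hanc_cases[OF that(4) ne])
        fix u assume "hpar u = relabel r x" "2 \<le> u" "u \<le> relabel r y"
        then show False using hchild_hpar(1)[of u] that by (simp add: node)
      qed (use that in \<open>simp add: node\<close>)
    qed
    show "\<exists>a<A. hanc (relabel r (relabel r (hchild (relabel r x) a))) (relabel r y)"
      if "inner x" "node y" "hanc (relabel r x) (relabel r y)" "x \<noteq> y" for x y
    proof -
      have ne: "relabel r x \<noteq> relabel r y" using that by (simp add: relabel_inj)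
      show ?thesis
      proof (rule hanc_cases[OF that(3) ne])
        fix u assume "hanc u (relabel r y)" "hpar u = relabel r x" "2 \<le> u" "u \<le> relabel r y"
        then show ?thesis using hchild_hpar(2)[of u] that by (auto simp: node)
      qed (use that in \<open>simp add: node\<close>)
    qed
    show "hanc (relabel r x) (relabel r y)"
      if x: "inner x" "a < A" and anc: "hanc (relabel r (relabel r (hchild (relabel r x) a))) (relabel r y)" for x a y
    proof -
      obtain k where "(hpar ^^ k) (relabel r y) = hchild (relabel r x) a" using anc by (auto simp: hanc_def)
      then have "(hpar ^^ Suc k) (relabel r y) = relabel r x" using hchild(4) x by (simp add: inner_def node)
      then show ?thesis unfolding hanc_def by blast
    qed
    show "hdep (relabel r x) \<le> hdep (relabel r y)" if "node y" "hanc (relabel r x) (relabel r y)" for x y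
      using that hdep_funpow_le[of "relabel r y"] unfolding hanc_def node by metis
  qed (use r A n in \<open>auto simp: inner_def node hchild hdep_hpar hdep_1\<close>)
qed

end

subsection \<open>The lower bound\<close>

text \<open>
  In the application \<open>\<delta> = 5 / (4 S)\<close> and \<open>\<gamma> = 5 / S\<close>, so that \<open>1 / \<gamma> + 1 / \<delta> = S\<close>.  The fraction of
  rounds that the optimal policy spends on the hidden arm, at least \<open>1 / (5/4 + 5/4 d / S)\<close> for a leaf of
  depth \<open>d\<close>, must exceed the fraction \<open>1 / \<kappa>\<close> that an uninformed learner can afford.
\<close>

lemma visit_gap:
  fixes S d \<delta> \<gamma> \<epsilon> \<kappa> :: real
  assumes S: "0 < S" and d: "0 \<le> d" and \<delta>: "\<delta> = 5 / (4 * S)" and \<gamma>: "\<gamma> = 5 / S"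
    and \<epsilon>: "0 \<le> \<epsilon>" "\<epsilon> < \<delta>" and \<kappa>: "0 < \<kappa>"
    and dichotomy: "2 \<le> \<kappa> \<and> 9 * d \<le> S \<or> 4 \<le> \<kappa> \<and> 2 * d \<le> S"
  shows "1 / ((\<delta> - \<epsilon>) * (1 / \<gamma> + d + 1 / (\<delta> - \<epsilon>))) - 1 / \<kappa> \<ge> 11 / 50"
proof -
  define X where "X = (\<delta> - \<epsilon>) * (1 / \<gamma> + d + 1 / (\<delta> - \<epsilon>))"
  have "X = (\<delta> - \<epsilon>) * (1 / \<gamma> + d) + 1"
    using \<epsilon> by (simp add: X_def distrib_left)
  also have "\<dots> \<le> \<delta> * (1 / \<gamma> + d) + 1"
    using \<epsilon> d S by (intro add_right_mono mult_right_mono) (auto simp: \<gamma>)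
  also have "\<dots> = 5 / 4 + 5 / 4 * (d / S)"
    using S by (simp add: \<delta> \<gamma> field_simps)
  finally have le: "X \<le> 5 / 4 + 5 / 4 * (d / S)" .
  have "0 < 1 / \<gamma>" "0 < 1 / (\<delta> - \<epsilon>)" using S \<epsilon> by (simp_all add: \<gamma>)
  then have pos: "0 < X"
    using \<epsilon> d unfolding X_def by (intro mult_pos_pos) linarith+
  have "11 / 50 \<le> 1 / X - 1 / \<kappa>"
    using dichotomy
  proof (elim disjE conjE)
    assume *: "2 \<le> \<kappa>" "9 * d \<le> S"
    then have "d / S \<le> 1 / 9" using S by (simp add: field_simps)
    then have "X \<le> 25 / 18" using le by linarith
    then have "18 / 25 \<le> 1 / X" using pos by (simp add: field_simps)
    moreover have "1 / \<kappa> \<le> 1 / 2" using * by (simp add: field_simps)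
    ultimately show ?thesis by linarith
  next
    assume *: "4 \<le> \<kappa>" "2 * d \<le> S"
    then have "d / S \<le> 1 / 2" using S by (simp add: field_simps)
    then have "X \<le> 15 / 8" using le by linarith
    then have "8 / 15 \<le> 1 / X" using pos by (simp add: field_simps)
    moreover have "1 / \<kappa> \<le> 1 / 4" using * by (simp add: field_simps)
    ultimately show ?thesis by linarith
  qed
  then show ?thesis by (simp only: X_def)
qed

text \<open>The chi-square divergence is about \<open>\<epsilon>\<^sup>2 / \<delta>\<close>, so this
  \<epsilon> makes the relative entropy accumulated over \<open>T / \<kappa>\<close> uses about
  \<open>1 / 100\<close>. The bound \<open>D * N \<le> T\<close> gives
  \<open>\<epsilon> \<le> \<delta> / 10\<close>, since \<open>1 \<le> \<delta> * D\<close>.\<close>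

lemma tuned_epsilon:
  fixes S D N T \<kappa> \<delta> \<gamma> \<epsilon> :: real
  assumes S: "9 \<le> S" "D \<le> 2 * S" "S \<le> D" and \<delta>: "\<delta> = 5 / (4 * S)" and \<gamma>: "\<gamma> = 5 / S"
    and \<kappa>: "0 < \<kappa>" "N \<le> 3 * \<kappa>" "\<kappa> \<le> N" and T: "D * N \<le> T"
    and \<epsilon>: "\<epsilon> = sqrt (\<delta> * \<kappa> / T) / 10"
  shows "0 \<le> \<epsilon>" "\<epsilon> \<le> \<delta> / 10"
    and "sqrt (\<epsilon>\<^sup>2 / ((\<delta> - \<epsilon>) * (1 - \<delta> + \<epsilon>)) * (T / \<kappa>)) \<le> 12 / 100"
    and "sqrt (D * N * T) / 3000 \<le> \<epsilon> * (1 / (\<gamma> + \<delta>)) * T * (1 / 10)"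
proof -
  have N: "0 < N" using \<kappa> by simp
  have D: "0 < D" using S by simp
  have Tpos: "0 < T" using T N D by (meson less_le_trans mult_pos_pos)
  have \<delta>_pos: "0 < \<delta>" "\<delta> \<le> 5 / 36" using S by (auto simp: \<delta> field_simps)
  show \<epsilon>0: "0 \<le> \<epsilon>" using \<delta>_pos \<kappa> Tpos by (simp add: \<epsilon>)
  have \<epsilon>2: "\<epsilon>\<^sup>2 = \<delta> * \<kappa> / T / 100"
    using \<delta>_pos \<kappa> Tpos by (simp add: \<epsilon> power_divide)
  have "\<delta> * \<kappa> / T \<le> \<delta> * \<delta>"
  proof -
    have "\<kappa> * 1 \<le> N * (\<delta> * D)"
      using \<kappa> N S \<delta>_pos by (intro mult_mono) (auto simp: \<delta> field_simps)
    also have "\<dots> \<le> \<delta> * T" using T \<delta>_pos by (simp add: algebra_simps mult_left_mono)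
    finally have "\<kappa> / T \<le> \<delta>" using Tpos by (simp add: field_simps)
    then show ?thesis using \<delta>_pos by (simp flip: times_divide_eq_right)
  qed
  then have "sqrt (\<delta> * \<kappa> / T) \<le> sqrt (\<delta> * \<delta>)" by (rule real_sqrt_le_mono)
  then show \<epsilon>1: "\<epsilon> \<le> \<delta> / 10" using \<delta>_pos by (simp add: \<epsilon>)
  show "sqrt (\<epsilon>\<^sup>2 / ((\<delta> - \<epsilon>) * (1 - \<delta> + \<epsilon>)) * (T / \<kappa>)) \<le> 12 / 100"
  proof (rule real_le_lsqrt)
    \<comment> \<open>\<open>9 / 10\<close> comes from
      \<open>\<epsilon> \<le> \<delta> / 10\<close>, and \<open>31 / 36\<close> from
      \<open>\<delta> \<le> 5 / 36\<close>.\<close>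
    have prod: "\<delta> * (9 / 10) * (31 / 36) \<le> (\<delta> - \<epsilon>) * (1 - \<delta> + \<epsilon>)"
      using \<epsilon>0 \<epsilon>1 \<delta>_pos by (intro mult_mono) auto
    have "\<epsilon>\<^sup>2 / ((\<delta> - \<epsilon>) * (1 - \<delta> + \<epsilon>)) * (T / \<kappa>) = \<delta> / 100 / ((\<delta> - \<epsilon>) * (1 - \<delta> + \<epsilon>))"
      using Tpos \<kappa> by (simp add: \<epsilon>2)
    also have "\<dots> \<le> \<delta> / 100 / (\<delta> * (9 / 10) * (31 / 36))"
      using prod \<delta>_pos by (intro divide_left_mono) (auto intro!: mult_pos_pos elim: less_le_trans[rotated])
    also have "\<dots> \<le> (12 / 100)\<^sup>2" using \<delta>_pos by (simp add: power2_eq_square)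
    finally show "\<epsilon>\<^sup>2 / ((\<delta> - \<epsilon>) * (1 - \<delta> + \<epsilon>)) * (T / \<kappa>) \<le> (12 / 100)\<^sup>2" .
  qed simp
  have "D * N * T \<le> (2 * S) * (3 * \<kappa>) * T"
    using S \<kappa> N D Tpos by (intro mult_mono) auto
  \<comment> \<open>The factor 6 is rounded up to \<open>144 / 5 = (24 / 5)^2 * 5 / 4\<close>: with
    \<open>24 / 5\<close> the final comparison becomes the equality
    \<open>48 / 3000 = (4 / 25) / 10\<close>.\<close>
  also have "\<dots> \<le> 144 / 5 * (S * \<kappa> * T)"
    using S \<kappa> Tpos by simp
  also have "\<dots> = (24 / 5 * S)\<^sup>2 * (\<delta> * \<kappa> * T)"
    using S by (simp add: \<delta> power2_eq_square)
  finally have "sqrt (D * N * T) \<le> sqrt ((24 / 5 * S)\<^sup>2 * (\<delta> * \<kappa> * T))"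
    by (rule real_sqrt_le_mono)
  also have "\<dots> = 24 / 5 * S * sqrt (\<delta> * \<kappa> * T)"
    using S by (simp add: real_sqrt_mult)
  also have "\<delta> * \<kappa> * T = \<delta> * \<kappa> / T * T\<^sup>2"
    using Tpos by (simp add: power2_eq_square)
  also have "sqrt \<dots> = sqrt (\<delta> * \<kappa> / T) * sqrt (T\<^sup>2)"
    by (rule real_sqrt_mult)
  also have "\<dots> = 10 * \<epsilon> * T"
    using Tpos by (simp add: \<epsilon>)
  finally have "sqrt (D * N * T) \<le> 24 / 5 * S * (10 * \<epsilon> * T)" .
  moreover have bias: "1 / (\<gamma> + \<delta>) = 4 * S / 25"
    using S by (simp add: \<gamma> \<delta> field_simps)
  ultimately show "sqrt (D * N * T) / 3000 \<le> \<epsilon> * (1 / (\<gamma> + \<delta>)) * T * (1 / 10)"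
    unfolding bias by (simp add: algebra_simps)
qed

lemma (in heap) hard_family_at:
  fixes Q E r T :: nat and D :: real
  assumes Q: "2 \<le> Q" and E: "4 \<le> E" and r: "r < n"
    and D: "real Q * (6 + 2 * log (real A) (real n)) \<le> D" and T: "D * real n * real A \<le> real T"
  shows "\<exists>F :: (nat, nat, nat, nat) mdprm set.
    (\<forall>M\<in>F. is_mdprm M \<and> obs_set M = {..<n} \<and> act_set M = {..<A} \<and> rm_states (machine M) = {..<Q} \<and>
      max_relevant M = E \<and> diameter_mdp (cross_product M) = ennreal D) \<and>
    (\<forall>q<Q. \<forall>alg. learning_algorithm {..<A} alg \<longrightarrow>
      (\<exists>M\<in>F. sqrt (D * real n * real A * real T) / 3000 \<le> expected_regret M alg (q, r) T))"
proof -
  interpret nt: nav_tree n A r "\<lambda>x. hleaf (relabel r x)" "relabel r 1"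
    "\<lambda>x a. relabel r (hchild (relabel r x) a)" "\<lambda>x. hdep (relabel r x)" "\<lambda>x. hhgt (relabel r x)"
    "\<lambda>x y. hanc (relabel r x) (relabel r y)"
    by (rule nav_tree_relabel[OF r])
  have node: "nt.node x \<longleftrightarrow> 1 \<le> relabel r x \<and> relabel r x < n" for x
    using r by (simp only: nt.node_def relabel_less relabel_eq_0) blast
  define L where "L = log (real A) (real n)"
  \<comment> \<open>What the integer legs of the longest itinerary leave of \<open>D\<close> for the
    two waiting times; any real \<open>D\<close> is then met exactly.\<close>
  define S where "S = D - real (Q - 1) - real nt.hmax - real nt.dmax"
  define \<delta> \<gamma> where "\<delta> = 5 / (4 * S)" and "\<gamma> = 5 / S"
  have L: "0 \<le> L" using A n by (simp add: L_def zero_le_log_cancel_iff)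
  have dmax: "real nt.dmax \<le> 1 + L"
    using nt.dmax_attained hdep_le_log unfolding L_def node by metis
  then have hmax: "real nt.hmax \<le> 1 + L" using nt.hmax_le_dmax by linarith
  have QL: "2 * L \<le> real Q * L" using Q L by (intro mult_right_mono) auto
  have D': "6 * real Q + 2 * (real Q * L) \<le> D" using D by (simp add: L_def algebra_simps)
  have Q': "real (Q - 1) = real Q - 1" "2 \<le> real Q" using Q by auto
  have sub: "0 \<le> D - S" "D - S \<le> real Q + 1 + 2 * L"
    using dmax hmax Q' by (simp_all add: S_def)
  \<comment> \<open>Here the hypothesis on \<open>D\<close> is spent: \<open>6 Q + 2 Q L\<close>
    against \<open>Q + 1 + 2 L\<close>, with \<open>2 \<le> Q\<close>.\<close>
  have S: "9 + 2 * L \<le> S" using sub QL D' Q'(2) by linarith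
  have S2: "D \<le> 2 * S" "S \<le> D" using sub QL D' Q'(2) by linarith+
  have S9: "9 \<le> S" using S L by linarith
  interpret hf: hard_family n A r "\<lambda>x. hleaf (relabel r x)" "relabel r 1"
    "\<lambda>x a. relabel r (hchild (relabel r x) a)" "\<lambda>x. hdep (relabel r x)" "\<lambda>x. hhgt (relabel r x)"
    "\<lambda>x y. hanc (relabel r x) (relabel r y)" Q E \<gamma> \<delta>
    by unfold_locales (use Q E S9 in \<open>auto simp: \<gamma>_def \<delta>_def\<close>)
  have "1 / \<delta> = 4 * S / 5" "1 / \<gamma> = S / 5" by (simp_all add: \<delta>_def \<gamma>_def)
  then have diam: "hf.diam = D" unfolding hf.diam_def using S_def by linarith

  let ?leaves = "{x. nt.node x \<and> hleaf (relabel r x)}"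
  define \<kappa> where "\<kappa> = real (card hf.arms)"
  have "?leaves = relabel r ` {v. 1 \<le> v \<and> v < n \<and> hleaf v}"
    by (auto simp: node image_iff) (metis relabel_relabel)
  then have "card ?leaves = card {v. 1 \<le> v \<and> v < n \<and> hleaf v}"
    by (simp add: card_image inj_on_def relabel_inj)
  then have leaves: "n div 2 \<le> card ?leaves" using card_leaves by simp
  have "card ?leaves \<le> card {..<n}" using r by (intro card_mono) (auto simp: nt.node_def)
  then have leaves': "card ?leaves \<le> n" by simp
  have \<kappa>: "\<kappa> = real (card ?leaves) * real A"
    by (simp add: \<kappa>_def hf.arms_def card_cartesian_product)
  have \<kappa>_le: "\<kappa> \<le> real n * real A" unfolding \<kappa> using leaves' by (intro mult_right_mono) auto
  have \<kappa>_ge: "real n * real A \<le> 3 * \<kappa>"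
  proof -
    have "n \<le> 3 * (n div 2)" using n by presburger
    then have "real n \<le> 3 * real (card ?leaves)" using leaves by linarith
    then show ?thesis unfolding \<kappa> using mult_right_mono[of "real n" "3 * real (card ?leaves)" "real A"] by simp
  qed
  have \<kappa>_pos: "0 < \<kappa>" using \<kappa>_ge n A by (smt (verit) mult_pos_pos of_nat_0_less_iff order_less_le_trans zero_less_numeral)
  have \<kappa>_2: "real (n div 2) * 2 \<le> \<kappa>" unfolding \<kappa> using leaves A by (intro mult_mono) auto
  \<comment> \<open>Three observation states may leave only two pairs, but at depth at most 1.
    Otherwise there are two leaves, hence four pairs, and the depth \<open>1 + L\<close> is at most
    \<open>S / 2\<close>.\<close>
  have dichotomy: "2 \<le> \<kappa> \<and> 9 * real (hdep (relabel r x)) \<le> S \<or> 4 \<le> \<kappa> \<and> 2 * real (hdep (relabel r x)) \<le> S"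
    if x: "nt.node x" for x
  proof (cases "n = 3")
    case True
    then have "hdep (relabel r x) \<le> 1" using hdep_le_1 x node by blast
    then show ?thesis using True \<kappa>_2 S9 by simp
  next
    case False
    then have "2 \<le> n div 2" using n by simp
    then have "4 \<le> \<kappa>" using \<kappa>_2 by linarith
    moreover have "real (hdep (relabel r x)) \<le> 1 + L" using nt.dep_le[OF x] dmax by linarith
    ultimately show ?thesis using S by linarith
  qed

  define \<epsilon> where "\<epsilon> = sqrt (\<delta> * \<kappa> / real T) / 10"
  have T': "D * (real n * real A) \<le> real T" using T by (simp add: mult.assoc)
  note tuned = tuned_epsilon[OF S9 S2 \<delta>_def \<gamma>_def \<kappa>_pos \<kappa>_ge \<kappa>_le T' \<epsilon>_def]
  have \<delta>_pos: "0 < \<delta>" using S9 by (simp add: \<delta>_def)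
  have p: "hf.perturbation \<epsilon>" using tuned(1,2) \<delta>_pos by (simp add: hf.perturbation_def)
  have arms: "hf.arms \<noteq> {}" using \<kappa>_pos by (auto simp: \<kappa>_def)
  have regret: "\<exists>z\<in>hf.arms. sqrt (D * real n * real A * real T) / 3000 \<le> expected_regret (hf.member \<epsilon> z) alg (q, r) T"
    if alg: "learning_algorithm {..<A} alg" and q: "q < Q" for alg q
  proof -
    obtain z where z: "z \<in> hf.arms" and le: "\<epsilon> * hf.bias * real T *
        (1 / ((\<delta> - \<epsilon>) * hf.cycle \<epsilon> (fst z)) - 1 / \<kappa> - sqrt (hf.chi_sq \<epsilon> * (real T / \<kappa>)))
      \<le> expected_regret (hf.member \<epsilon> z) alg (q, r) T"
      using hf.expected_regret_ge[OF p arms alg q, where T=T] unfolding \<kappa>_def by blast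
    have "nt.node (fst z)" using z by (auto simp: hf.arms_def)
    from visit_gap[OF _ _ \<delta>_def \<gamma>_def tuned(1) _ \<kappa>_pos dichotomy[OF this]]
    have "11 / 50 \<le> 1 / ((\<delta> - \<epsilon>) * hf.cycle \<epsilon> (fst z)) - 1 / \<kappa>"
      using S9 tuned(2) \<delta>_pos by (simp add: hf.cycle_def)
    \<comment> \<open>\<open>11 / 50 - 12 / 100 = 1 / 10\<close>.\<close>
    then have gap: "1 / 10 \<le> 1 / ((\<delta> - \<epsilon>) * hf.cycle \<epsilon> (fst z)) - 1 / \<kappa> - sqrt (hf.chi_sq \<epsilon> * (real T / \<kappa>))"
      using tuned(3) unfolding hf.chi_sq_def by linarith
    have "sqrt (D * real n * real A * real T) / 3000 \<le> \<epsilon> * hf.bias * real T * (1 / 10)"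
      using tuned(4) by (simp add: hf.bias_def mult.assoc)
    also have "\<dots> \<le> expected_regret (hf.member \<epsilon> z) alg (q, r) T"
      using tuned(1) hf.bias_pos by (intro order_trans[OF mult_left_mono[OF gap] le]) simp
    finally show ?thesis using z by blast
  qed
  have family: "is_mdprm (hf.member \<epsilon> z) \<and> obs_set (hf.member \<epsilon> z) = {..<n} \<and>
      act_set (hf.member \<epsilon> z) = {..<A} \<and> rm_states (machine (hf.member \<epsilon> z)) = {..<Q} \<and>
      max_relevant (hf.member \<epsilon> z) = E \<and> diameter_mdp (cross_product (hf.member \<epsilon> z)) = ennreal D" for z
    by (intro conjI hf.member_simps hf.is_mdprm_member hf.max_relevant_member
        hf.diameter_cross[OF p, unfolded diam])
  show ?thesis
  proof (intro exI[of _ "hf.member \<epsilon> ` hf.arms"] conjI[OF ballI] allI impI)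
    fix M assume "M \<in> hf.member \<epsilon> ` hf.arms"
    then obtain z where "M = hf.member \<epsilon> z" by (elim imageE)
    then show "is_mdprm M \<and> obs_set M = {..<n} \<and> act_set M = {..<A} \<and> rm_states (machine M) = {..<Q} \<and>
        max_relevant M = E \<and> diameter_mdp (cross_product M) = ennreal D"
      using family[of z] by (simp only:)
  next
    fix q and alg :: "(nat, nat, nat, nat) learner"
    assume q: "q < Q" and alg: "learning_algorithm {..<A} alg"
    from regret[OF alg q]
    show "\<exists>M\<in>hf.member \<epsilon> ` hf.arms.
        sqrt (D * real n * real A * real T) / 3000 \<le> expected_regret M alg (q, r) T"
      by (elim bexE) (rule bexI[OF _ imageI])
  qed
qed

theorem theorem5:
  "\<exists>c\<^sub>0>0. \<forall>(nO::nat) (nA::nat) (nQ::nat) (nE::nat) (D::real) (T::nat).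
     nO \<ge> 3 \<longrightarrow> nA \<ge> 2 \<longrightarrow> nQ \<ge> 2 \<longrightarrow> nE \<ge> 4 \<longrightarrow>
     D \<ge> real nQ * (6 + 2 * log (real nA) (real nO)) \<longrightarrow>
     real T \<ge> D * real nO * real nA \<longrightarrow>
     (\<exists>(Q :: nat set) (Obs :: nat set) (A :: nat set) (F :: (nat, nat, nat, nat) mdprm set).
        card Obs = nO \<and> card A = nA \<and> card Q = nQ \<and>
        (\<forall>M\<in>F. is_mdprm M \<and> obs_set M = Obs \<and> act_set M = A \<and>
           rm_states (machine M) = Q \<and> max_relevant M = nE \<and>
           diameter_mdp (cross_product M) = ennreal D) \<and>
        (\<forall>s\<^sub>1\<in>Q \<times> Obs. \<forall>alg. learning_algorithm A alg \<longrightarrow>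
           (\<exists>M\<in>F. expected_regret M alg s\<^sub>1 T \<ge> c\<^sub>0 * sqrt (D * real nO * real nA * real T))))"
proof (intro exI[of _ "1 / 3000"] conjI allI impI)
  fix nO nA nQ nE T :: nat and D :: real
  assume n: "3 \<le> nO" and A: "2 \<le> nA" and Q: "2 \<le> nQ" and E: "4 \<le> nE"
    and D: "real nQ * (6 + 2 * log (real nA) (real nO)) \<le> D" and T: "D * real nO * real nA \<le> real T"
  interpret heap nO nA by unfold_locales (use n A in auto)
  \<comment> \<open>The family has to be fixed before the starting state \<open>(q, r)\<close> is
    known, so all \<open>F r\<close> are united in the end.\<close>
  obtain F :: "nat \<Rightarrow> (nat, nat, nat, nat) mdprm set" where F: "\<And>r M. r < nO \<Longrightarrow> M \<in> F r \<Longrightarrow>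
      is_mdprm M \<and> obs_set M = {..<nO} \<and> act_set M = {..<nA} \<and> rm_states (machine M) = {..<nQ} \<and>
      max_relevant M = nE \<and> diameter_mdp (cross_product M) = ennreal D"
    and regret: "\<And>r q alg. r < nO \<Longrightarrow> q < nQ \<Longrightarrow> learning_algorithm {..<nA} alg \<Longrightarrow>
      \<exists>M\<in>F r. sqrt (D * real nO * real nA * real T) / 3000 \<le> expected_regret M alg (q, r) T"
    using hard_family_at[OF Q E _ D T] by metis
  show "\<exists>(Q :: nat set) (Obs :: nat set) (A :: nat set) (F :: (nat, nat, nat, nat) mdprm set).
        card Obs = nO \<and> card A = nA \<and> card Q = nQ \<and>
        (\<forall>M\<in>F. is_mdprm M \<and> obs_set M = Obs \<and> act_set M = A \<and>
           rm_states (machine M) = Q \<and> max_relevant M = nE \<and>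
           diameter_mdp (cross_product M) = ennreal D) \<and>
        (\<forall>s\<^sub>1\<in>Q \<times> Obs. \<forall>alg. learning_algorithm A alg \<longrightarrow>
           (\<exists>M\<in>F. expected_regret M alg s\<^sub>1 T \<ge> 1 / 3000 * sqrt (D * real nO * real nA * real T)))"
  proof (intro exI conjI)
    show "\<forall>M\<in>\<Union>(F ` {..<nO}). is_mdprm M \<and> obs_set M = {..<nO} \<and> act_set M = {..<nA} \<and>
        rm_states (machine M) = {..<nQ} \<and> max_relevant M = nE \<and> diameter_mdp (cross_product M) = ennreal D"
      using F by blast
    show "\<forall>s\<^sub>1\<in>{..<nQ} \<times> {..<nO}. \<forall>alg. learning_algorithm {..<nA} alg \<longrightarrow>
        (\<exists>M\<in>\<Union>(F ` {..<nO}). expected_regret M alg s\<^sub>1 T \<ge> 1 / 3000 * sqrt (D * real nO * real nA * real T))"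
      using regret by fastforce
  qed simp_all
qed simp

end
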